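(* Let $X$ be an oriented graph with vertex $a$. If there is local uniform mixing at $a$ in $X$, then the eigenvalue support of $a$ satisfies the ratio condition.
   Context: An oriented graph consists of a finite set of vertices and a set of arcs, where an arc is an ordered pair of distinct vertices and any two vertices lie in at most one arc. Its adjacency matrix $S$ is the skew-symmetric matrix with $S_{u,v}=1$ if $uv$ is an arc, $S_{u,v}=-1$ if $vu$ is an arc, and $S_{u,v}=0$ otherwise. The transition matrix is $U(t)=\exp(it(-iS))=\exp(tS)$ for real $t$. For a vertex $a$ let $e_a$ be the standard basis vector indexed by $a$, $D_a=e_ae_a^T$, and $D_a(t)=U(t)D_aU(-t)$. There is local uniform mixing at $a$ if there is a time $t$ such that $D_a(t)\circ I=\frac1n I$, where $n=|V(X)|$ and $\circ$ is the entrywise product (equivalently, all entries of $U(t)e_a$ have the same absolute value). Write the spectral decomposition $S=\sum_r i\lambda_rF_r$, with distinct real $\lambda_r$ and $F_r$ the Hermitian matrix of orthogonal projection onto the $i\lambda_r$-eigenspace. The eigenvalue support of $a$ is the set of eigenvalues $i\lambda_r$ with $F_re_a\neq0$. It satisfies the ratio condition if $\frac{\lambda_r-\lambda_s}{\lambda_k-\lambda_\ell}\in\mathbb{Q}$ whenever $i\lambda_r,i\lambda_s,i\lambda_k,i\lambda_\ell$ lie in the eigenvalue support of $a$ and $\lambda_k\neq\lambda_\ell$. *)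

theory Defs
  imports "HOL-Analysis.Analysis"
begin

section \<open>Oriented graphs\<close>

text \<open>
  The vertex set is a finite type \<open>'v\<close>, so \<open>n\<close> is \<open>CARD('v)\<close>, and a graph is given by its set of
  arcs; the vectors and matrices attached to it are indexed by \<open>'v\<close>.
\<close>

definition oriented_graph :: "('v \<times> 'v) set \<Rightarrow> bool" where
  "oriented_graph E \<longleftrightarrow> (\<forall>u v. (u, v) \<in> E \<longrightarrow> u \<noteq> v \<and> (v, u) \<notin> E)"

definition skew_adjacency :: "('v::finite \<times> 'v) set \<Rightarrow> complex^'v^'v" where
  "skew_adjacency E = (\<chi> u v. if (u, v) \<in> E then 1 else if (v, u) \<in> E then -1 else 0)"


section \<open>Continuous walks and mixing\<close>

text \<open>
  The product \<open>*\<close> on \<open>complex^'n^'n\<close> is the entrywise one, so \<open>^\<close> and \<open>exp\<close> are of no use for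
  the matrix product \<open>**\<close>; powers and exponential with respect to \<open>**\<close> are defined here.
\<close>

primrec mat_pow :: "complex^'n^'n \<Rightarrow> nat \<Rightarrow> complex^'n^('n::finite)" where
  "mat_pow M 0 = mat 1"
| "mat_pow M (Suc k) = M ** mat_pow M k"

definition mat_exp :: "complex^'n^'n \<Rightarrow> complex^'n^('n::finite)" where
  "mat_exp M = (\<Sum>k. (1 / fact k) *\<^sub>R mat_pow M k)"

definition transition :: "('v::finite \<times> 'v) set \<Rightarrow> real \<Rightarrow> complex^'v^'v" where
  "transition E t = mat_exp (t *\<^sub>R skew_adjacency E)"

definition vertex_density :: "'v::finite \<Rightarrow> complex^'v^'v" where
  "vertex_density a = (\<chi> u v. axis a 1 $ u * axis a 1 $ v)"

definition evolved_density :: "('v::finite \<times> 'v) set \<Rightarrow> 'v \<Rightarrow> real \<Rightarrow> complex^'v^'v" where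
  "evolved_density E a t = transition E t ** vertex_density a ** transition E (- t)"

definition schur_product :: "complex^'n^'m \<Rightarrow> complex^'n^'m \<Rightarrow> complex^'n^'m" where
  "schur_product M N = (\<chi> u v. M $ u $ v * N $ u $ v)"

definition local_uniform_mixing :: "('v::finite \<times> 'v) set \<Rightarrow> 'v \<Rightarrow> bool" where
  "local_uniform_mixing E a \<longleftrightarrow>
     (\<exists>t. schur_product (evolved_density E a t) (mat 1) = (1 / real CARD('v)) *\<^sub>R mat 1)"


section \<open>Eigenvalue support and the ratio condition\<close>

definition eigenspace :: "complex^'n^'n \<Rightarrow> complex \<Rightarrow> (complex^('n::finite)) set" where
  "eigenspace M \<theta> = {x. M *v x = \<theta> *s x}"

definition is_eigenvalue :: "complex^'n^'n \<Rightarrow> complex \<Rightarrow> bool" where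
  "is_eigenvalue M \<theta> \<longleftrightarrow> (\<exists>x \<in> eigenspace M \<theta>. x \<noteq> 0)"

definition conj_transpose :: "complex^'n^'m \<Rightarrow> complex^'m^'n" where
  "conj_transpose M = (\<chi> i j. cnj (M $ j $ i))"

definition is_orth_projection :: "complex^'n^'n \<Rightarrow> (complex^('n::finite)) set \<Rightarrow> bool" where
  "is_orth_projection F W \<longleftrightarrow>
     conj_transpose F = F \<and> F ** F = F \<and> range (\<lambda>x. F *v x) = W"

text \<open>
  The description is well defined for every matrix and every complex number: see
  \<open>is_orth_projection_eigenprojection\<close> and \<open>is_orth_projection_unique\<close> below.
\<close>

definition eigenprojection :: "complex^'n^'n \<Rightarrow> complex \<Rightarrow> complex^'n^('n::finite)" where
  "eigenprojection M \<theta> = (THE F. is_orth_projection F (eigenspace M \<theta>))"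

definition eigenvalue_support :: "('v::finite \<times> 'v) set \<Rightarrow> 'v \<Rightarrow> complex set" where
  "eigenvalue_support E a =
     {\<theta>. is_eigenvalue (skew_adjacency E) \<theta> \<and>
          eigenprojection (skew_adjacency E) \<theta> *v axis a 1 \<noteq> 0}"

text \<open>
  The eigenvalues of a skew-symmetric real matrix are purely imaginary, so quantifying over
  those elements of \<open>\<Phi>\<close> that are of the form \<open>\<i> \<mu>\<close> with \<open>\<mu>\<close> real misses none of them.
\<close>

definition ratio_condition :: "complex set \<Rightarrow> bool" where
  "ratio_condition \<Phi> \<longleftrightarrow>
     (\<forall>\<mu>\<^sub>r \<mu>\<^sub>s \<mu>\<^sub>k \<mu>\<^sub>l :: real.
        \<i> * of_real \<mu>\<^sub>r \<in> \<Phi> \<and> \<i> * of_real \<mu>\<^sub>s \<in> \<Phi> \<and>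
        \<i> * of_real \<mu>\<^sub>k \<in> \<Phi> \<and> \<i> * of_real \<mu>\<^sub>l \<in> \<Phi> \<and> \<mu>\<^sub>k \<noteq> \<mu>\<^sub>l \<longrightarrow>
        (\<mu>\<^sub>r - \<mu>\<^sub>s) / (\<mu>\<^sub>k - \<mu>\<^sub>l) \<in> \<rat>)"


section \<open>Well-definedness\<close>

lemma conj_transpose_mult: "conj_transpose (A ** B) = conj_transpose B ** conj_transpose A"
  for A B :: "complex^'n^('n::finite)"
  by (simp add: conj_transpose_def matrix_matrix_mult_def vec_eq_iff mult.commute)

lemma is_orth_projection_unique:
  assumes "is_orth_projection F W" "is_orth_projection G W"
  shows "F = G"
proof -
  have absorb: "A ** B = B" if "is_orth_projection A W" "is_orth_projection B W" for A B
  proof (rule iffD2[OF matrix_eq], rule allI)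
    fix x
    have "B *v x \<in> range (\<lambda>x. A *v x)"
      using that by (auto simp: is_orth_projection_def)
    then obtain y where y: "B *v x = A *v y" by auto
    have "A *v (A *v y) = A *v y"
      using that(1) by (simp add: is_orth_projection_def matrix_vector_mul_assoc)
    then show "(A ** B) *v x = B *v x"
      by (simp flip: matrix_vector_mul_assoc add: y)
  qed
  have "F = conj_transpose (G ** F)"
    using absorb[OF assms(2,1)] assms by (simp add: is_orth_projection_def)
  also have "\<dots> = F ** G"
    using assms by (simp add: conj_transpose_mult is_orth_projection_def)
  also have "\<dots> = G" by (rule absorb[OF assms])
  finally show ?thesis .
qed

lemma is_orth_projection_exists:
  fixes W :: "(complex^('n::finite)) set"
  assumes W0: "0 \<in> W"
    and Wadd: "\<And>x y. x \<in> W \<Longrightarrow> y \<in> W \<Longrightarrow> x + y \<in> W"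
    and Wsc: "\<And>c x. x \<in> W \<Longrightarrow> c *s x \<in> W"
  shows "\<exists>F. is_orth_projection F W"
proof -
  define h :: "complex^'n \<Rightarrow> complex^'n \<Rightarrow> complex" where
    "h x y = (\<Sum>i\<in>UNIV. x $ i * cnj (y $ i))" for x y
  have hadd: "h (x + y) z = h x z + h y z" and hsc: "h (c *s x) z = c * h x z"
    and hdiff: "h (x - y) z = h x z - h y z"
    and hadd2: "h z (x + y) = h z x + h z y" and hsc2: "h z (c *s x) = cnj c * h z x"
    and hcnj: "h y x = cnj (h x y)" for x y z c
    by (simp_all add: h_def algebra_simps sum.distrib sum_distrib_left sum_subtractf)
  have inner: "x \<bullet> y = Re (h x y)" for x y
    by (simp add: inner_vec_def h_def inner_complex_def)
  have hself: "x = 0" if "h x x = 0" for x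
    using that inner[of x x] by simp
  have sc: "r *\<^sub>R x = of_real r *s x" for r :: real and x :: "complex^'n"
    by (simp add: vec_eq_iff scaleR_conv_of_real[where 'a = complex])
  have sub: "subspace W"
    by (simp add: subspace_def W0 Wadd sc Wsc)
  then have span: "span W = W" by (simp add: span_eq_iff)
  have "\<exists>y. y \<in> W \<and> (\<forall>w\<in>W. h (x - y) w = 0)" for x
  proof -
    obtain y z where y: "y \<in> W" and z: "\<And>w. w \<in> W \<Longrightarrow> orthogonal z w" and x: "x = y + z"
      using orthogonal_subspace_decomp_exists[of W x] span by metis
    have "h z w = 0" if w: "w \<in> W" for w
    proof -
      have "Re (h z w) = 0"
        using z[OF w] by (simp add: orthogonal_def inner)
      moreover have "Re (h z (\<i> *s w)) = 0"
        using z[OF Wsc[OF w]] by (simp add: orthogonal_def inner)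
      ultimately show ?thesis by (simp add: hsc2 complex_eq_iff)
    qed
    then show ?thesis using y x by auto
  qed
  then obtain P where P: "P x \<in> W" and Po: "\<And>w. w \<in> W \<Longrightarrow> h (x - P x) w = 0" for x
    by metis
  have neg: "x - y \<in> W" if "x \<in> W" "y \<in> W" for x y
    using sub that by (rule subspace_diff)
  have uniq: "P x = y" if y: "y \<in> W" and o: "\<And>w. w \<in> W \<Longrightarrow> h (x - y) w = 0" for x y
  proof -
    have d: "P x - y \<in> W" by (rule neg[OF P y])
    have "h (P x - y) (P x - y) = h (x - y) (P x - y) - h (x - P x) (P x - y)"
      by (simp flip: hdiff)
    also have "\<dots> = 0" using o[OF d] Po[OF d] by simp
    finally show ?thesis using hself by fastforce
  qed
  have lin: "Vector_Spaces.linear (*s) (*s) P"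
  proof (unfold_locales, goal_cases)
    case (1 x y)
    show ?case
    proof (rule uniq[OF Wadd[OF P P]])
      fix w assume "w \<in> W"
      then show "h (x + y - (P x + P y)) w = 0"
        using Po[of w x] Po[of w y] by (simp add: hadd hdiff)
    qed
  next
    case (2 c x)
    show ?case
    proof (rule uniq[OF Wsc[OF P]])
      fix w assume "w \<in> W"
      then show "h (c *s x - c *s P x) w = 0"
        using Po[of w x] by (simp add: hsc hdiff)
    qed
  qed
  define F where "F = matrix P"
  have F: "F *v x = P x" for x
    unfolding F_def by (rule matrix_works[OF lin])
  have PW: "P x = x" if "x \<in> W" for x
    by (rule uniq[OF that]) (simp add: h_def)
  have sym: "h (P x) y = h x (P y)" for x y
  proof -
    have "h x (P y) = h (P x) (P y)"
      using Po[OF P, of x y] by (simp add: hdiff)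
    also have "\<dots> = h (P x) y"
      using Po[OF P, of y x] hcnj[of "P x" "P y"] hcnj[of "P x" y]
      by (simp add: hdiff)
    finally show ?thesis by simp
  qed
  have ent: "h (F *v axis j 1) (axis i 1) = F $ i $ j" for i j
    by (simp add: h_def axis_def matrix_vector_mult_def if_distrib if_distribR cong: if_cong)
  have "conj_transpose F $ i $ j = F $ i $ j" for i j
  proof -
    have "F $ i $ j = h (axis j 1) (P (axis i 1))"
      by (simp add: ent[symmetric] F sym)
    also have "\<dots> = cnj (h (P (axis i 1)) (axis j 1))"
      by (rule hcnj)
    also have "\<dots> = conj_transpose F $ i $ j"
      by (simp add: conj_transpose_def ent[symmetric] F)
    finally show ?thesis by simp
  qed
  then have "conj_transpose F = F" by (simp add: vec_eq_iff)
  moreover have "F ** F = F"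
    by (rule iffD2[OF matrix_eq]) (simp add: matrix_vector_mul_assoc[symmetric] F PW P)
  moreover have "range (\<lambda>x. F *v x) = W"
  proof -
    have "(\<lambda>x. F *v x) = P" using F by auto
    moreover have "range P = W" using P PW by (auto simp: image_iff) metis
    ultimately show ?thesis by simp
  qed
  ultimately show ?thesis by (auto simp: is_orth_projection_def)
qed

lemma is_orth_projection_eigenprojection:
  "is_orth_projection (eigenprojection M \<theta>) (eigenspace M \<theta>)"
proof -
  have "\<exists>F. is_orth_projection F (eigenspace M \<theta>)"
    by (rule is_orth_projection_exists)
       (auto simp: eigenspace_def matrix_vector_right_distrib vec.scale vec.scale_right_distrib
          mult.commute)
  then have "\<exists>!F. is_orth_projection F (eigenspace M \<theta>)"
    using is_orth_projection_unique by blast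
  then show ?thesis
    unfolding eigenprojection_def by (rule theI')
qed

lemma norm_mat_pow_entry:
  fixes M :: "complex^'n^('n::finite)"
  assumes "\<And>i j. norm (M $ i $ j) \<le> b"
  shows "norm (mat_pow M k $ i $ j) \<le> (real CARD('n) * b) ^ k"
proof (induction k arbitrary: i j)
  case 0
  then show ?case by (simp add: mat_def)
next
  case (Suc k)
  have b: "0 \<le> b" using assms[of i i] norm_ge_zero order_trans by blast
  have "norm (mat_pow M (Suc k) $ i $ j)
      \<le> (\<Sum>l\<in>UNIV. norm (M $ i $ l * mat_pow M k $ l $ j))"
    by (simp add: matrix_matrix_mult_def norm_sum)
  also have "\<dots> \<le> (\<Sum>l\<in>(UNIV::'n set). b * (real CARD('n) * b) ^ k)"
    unfolding norm_mult by (intro sum_mono mult_mono assms Suc b norm_ge_zero)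
  also have "\<dots> = (real CARD('n) * b) ^ Suc k" by simp
  finally show ?case .
qed

lemma summable_mat_exp:
  fixes M :: "complex^'n^('n::finite)"
  shows "summable (\<lambda>k. (1 / fact k) *\<^sub>R mat_pow M k)"
proof (rule summable_comparison_test')
  define b where "b = (\<Sum>i\<in>UNIV. \<Sum>j\<in>UNIV. norm (M $ i $ j))"
  have b: "norm (M $ i $ j) \<le> b" for i j
  proof -
    have "norm (M $ i $ j) \<le> (\<Sum>j\<in>UNIV. norm (M $ i $ j))"
      by (rule member_le_sum) auto
    also have "\<dots> \<le> b" unfolding b_def
      by (rule member_le_sum[of i UNIV "\<lambda>i. \<Sum>j\<in>UNIV. norm (M $ i $ j)"])
         (auto intro: sum_nonneg)
    finally show ?thesis .
  qed
  let ?n = "real CARD('n)"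
  show "summable (\<lambda>k. ?n * ?n * ((?n * b) ^ k /\<^sub>R fact k))"
    by (intro summable_mult summable_exp_generic)
  fix k
  have "norm (mat_pow M k) \<le> (\<Sum>i\<in>(UNIV::'n set). \<Sum>j\<in>(UNIV::'n set). norm (mat_pow M k $ i $ j))"
    unfolding norm_vec_def[where 'a = "complex^'n"]
    by (rule order_trans[OF L2_set_le_sum])
       (auto intro!: sum_mono simp: norm_vec_def[where 'a = complex] L2_set_le_sum)
  also have "\<dots> \<le> (\<Sum>i\<in>(UNIV::'n set). \<Sum>j\<in>(UNIV::'n set). (?n * b) ^ k)"
    by (intro sum_mono norm_mat_pow_entry b)
  finally have "norm (mat_pow M k) \<le> ?n * ?n * (?n * b) ^ k" by (simp add: algebra_simps)
  then have "norm (mat_pow M k) / fact k \<le> ?n * ?n * (?n * b) ^ k / fact k"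
    by (intro divide_right_mono) auto
  then show "norm ((1 / fact k) *\<^sub>R mat_pow M k) \<le> ?n * ?n * ((?n * b) ^ k /\<^sub>R fact k)"
    by (simp add: field_simps)
qed

end

theory Submission
  imports Defs "HOL-Complex_Analysis.Complex_Analysis" "HOL-Real_Asymp.Real_Asymp"
begin

text \<open>
  Let \<open>U(t) e\<^sub>a\<close> be uniform. Its entries are the numbers \<open>\<plusminus> 1 / sqrt n\<close>, because \<open>U(t)\<close> is real
  orthogonal; in particular they are algebraic. If \<open>F\<close> projects to the eigenspace of an eigenvalue
  \<open>\<theta>\<close> in the support of \<open>a\<close>, then \<open>F U(t) e\<^sub>a = exp (t \<theta>) F e\<^sub>a\<close>, and since \<open>S\<close> has integer entries
  and \<open>F e\<^sub>a \<noteq> 0\<close>, both \<open>\<theta>\<close> and \<open>exp (t \<theta>)\<close> are algebraic (\<open>algebraic_exp_eigenvalue\<close>). For two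
  eigenvalues \<open>\<i> \<mu>\<close> and \<open>\<i> \<nu>\<close> in the support with \<open>\<nu> \<noteq> 0\<close>, the number
  \<open>exp (t \<i> \<mu>) = exp ((\<mu> / \<nu>) (t \<i> \<nu>))\<close> is thus a power of the algebraic number \<open>exp (t \<i> \<nu>)\<close> with
  an algebraic exponent, and it is algebraic. By the theorem of Gelfond and Schneider \<open>\<mu> / \<nu>\<close> is
  rational. Hence all eigenvalues in the support are rational multiples of a single one, and the ratio
  condition follows. The time is nonzero unless the graph is a single vertex, where 0 is the only
  eigenvalue.
  
  The greater part of what follows proves the theorem of Gelfond and Schneider by Schneider's method
  (\<open>gelfond_schneider\<close>). Three tools carry it: Siegel's lemma (\<open>siegel\<close>), Liouville's inequality
  (\<open>liouville_lower_bound\<close>), and the Schwarz lemma for functions with many zeros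
  (\<open>schwarz_many_zeros\<close>). The arithmetic is done without number fields or conjugates: a finitely
  generated subgroup of the complex numbers on which the relevant algebraic integers act by integer
  matrices is enough, and Siegel's lemma yields Liouville's inequality and the closure of the
  algebraic numbers under sums and products as well.
\<close>

section \<open>Siegel's lemma\<close>

text \<open>
  Siegel's lemma, by pigeonhole: with \<open>X\<close> of size \<open>2 |I| A\<close>, there are more integer vectors with entries
  in \<open>{0..X}\<close> than there are possible values of the system of linear forms on them, and the
  difference of two vectors with the same value is a solution. Having twice as many unknowns as
  equations makes the bound linear in \<open>A\<close>.
\<close>

lemma siegel:
  fixes a :: "'j \<Rightarrow> 'i \<Rightarrow> int" and A :: real
  assumes I: "finite I" "I \<noteq> {}" and J: "finite J" and IJ: "2 * card J \<le> card I"
    and A: "1 \<le> A" and aA: "\<And>j i. j \<in> J \<Longrightarrow> i \<in> I \<Longrightarrow> \<bar>of_int (a j i)\<bar> \<le> A"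
  obtains x :: "'i \<Rightarrow> int" where "\<exists>i\<in>I. x i \<noteq> 0"
    and "\<And>i. i \<in> I \<Longrightarrow> \<bar>of_int (x i)\<bar> \<le> 2 * real (card I) * A"
    and "\<And>j. j \<in> J \<Longrightarrow> (\<Sum>i\<in>I. a j i * x i) = 0"
proof -
  define n where "n = card I"
  define B where "B = \<lfloor>A\<rfloor>"
  have B1: "1 \<le> B" using A by (simp add: B_def)
  have BA: "of_int B \<le> A" by (simp add: B_def)
  have aB: "\<bar>a j i\<bar> \<le> B" if "j \<in> J" "i \<in> I" for j i
    using aA[OF that] by (simp add: B_def le_floor_iff)
  have n1: "1 \<le> n" using I by (simp add: n_def Suc_leI card_gt_0_iff)
  define X where "X = 2 * int n * B"
  have X2: "2 \<le> X" using n1 B1 mult_mono[of 1 "int n" 1 B] by (simp add: X_def)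
  define S where "S = PiE I (\<lambda>_. {0..X})"
  define Y where "Y = int n * B * X"
  define T where "T = PiE J (\<lambda>_. {-Y..Y})"
  define \<phi> where "\<phi> x = restrict (\<lambda>j. \<Sum>i\<in>I. a j i * x i) J" for x :: "'i \<Rightarrow> int"
  have cS: "card S = nat (X + 1) ^ n"
    using I by (simp add: S_def card_PiE n_def)
  have YX: "2 * Y = X\<^sup>2" by (simp add: Y_def X_def power2_eq_square)
  have cT: "card T = nat (X\<^sup>2 + 1) ^ card J"
  proof -
    have "nat (Y + 1 + Y) = nat (X\<^sup>2 + 1)" using YX by (simp add: algebra_simps)
    then show ?thesis using J by (simp add: T_def card_PiE)
  qed
  have ph: "\<phi> ` S \<subseteq> T"
  proof
    fix y assume "y \<in> \<phi> ` S"
    then obtain x where x: "x \<in> S" "y = \<phi> x" by auto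
    have "(\<Sum>i\<in>I. a j i * x i) \<in> {-Y..Y}" if j: "j \<in> J" for j
    proof -
      have "\<bar>\<Sum>i\<in>I. a j i * x i\<bar> \<le> (\<Sum>i\<in>I. \<bar>a j i * x i\<bar>)" by (rule sum_abs)
      also have "\<dots> \<le> (\<Sum>i\<in>I. B * X)"
      proof (rule sum_mono)
        fix i assume i: "i \<in> I"
        then have "0 \<le> x i" "x i \<le> X" using x by (auto simp: S_def PiE_iff)
        then show "\<bar>a j i * x i\<bar> \<le> B * X"
          unfolding abs_mult using aB[OF j i] by (intro mult_mono) auto
      qed
      also have "\<dots> = Y" by (simp add: Y_def n_def)
      finally show ?thesis by (simp add: abs_le_iff)
    qed
    then show "y \<in> T" using x by (auto simp: T_def \<phi>_def)
  qed
  have fT: "finite T" using J by (auto simp: T_def intro: finite_PiE)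
  have "card (\<phi> ` S) \<le> card T" by (rule card_mono[OF fT ph])
  also have "card T < card S"
  proof (cases "card J = 0")
    case True
    then show ?thesis using X2 n1 one_less_power[of "nat (X + 1)" n] by (simp add: cT cS)
  next
    case False
    \<comment> \<open>Two unknowns against one equation: this is where the factor 2 in the hypothesis enters.\<close>
    have "nat (X\<^sup>2 + 1) < nat (X + 1) ^ 2"
    proof -
      have "X\<^sup>2 + 1 < (X + 1)\<^sup>2" using X2 by (simp add: power2_eq_square algebra_simps)
      then show ?thesis using X2 by (simp flip: nat_power_eq)
    qed
    then have "card T < (nat (X + 1) ^ 2) ^ card J"
      unfolding cT using False by (intro power_strict_mono) auto
    also have "\<dots> = nat (X + 1) ^ (2 * card J)" by (simp add: power_mult)
    also have "\<dots> \<le> card S"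
      unfolding cS using IJ X2 by (intro power_increasing) (auto simp: n_def)
    finally show ?thesis .
  qed
  finally have "\<not> inj_on \<phi> S" by (rule pigeonhole)
  then obtain x y where xy: "x \<in> S" "y \<in> S" "x \<noteq> y" "\<phi> x = \<phi> y"
    by (auto simp: inj_on_def)
  show ?thesis
  proof (rule that[of "\<lambda>i. x i - y i"])
    show "\<exists>i\<in>I. x i - y i \<noteq> 0"
    proof (rule ccontr)
      assume "\<not> ?thesis"
      then have "\<And>i. i \<in> I \<Longrightarrow> x i = y i" by auto
      then have "x = y" using xy unfolding S_def by (metis PiE_ext)
      then show False using xy by simp
    qed
  next
    fix i assume i: "i \<in> I"
    have "0 \<le> x i" "x i \<le> X" "0 \<le> y i" "y i \<le> X" using xy i by (auto simp: S_def PiE_iff)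
    then have "\<bar>x i - y i\<bar> \<le> X" by linarith
    then have "\<bar>of_int (x i - y i)\<bar> \<le> real_of_int X" by (simp only: of_int_abs[symmetric] of_int_le_iff)
    also have "\<dots> \<le> 2 * real n * A" using BA by (simp add: X_def mult_left_mono)
    finally show "\<bar>of_int (x i - y i)\<bar> \<le> 2 * real (card I) * A" by (simp add: n_def)
  next
    fix j assume j: "j \<in> J"
    have "(\<Sum>i\<in>I. a j i * x i) = (\<Sum>i\<in>I. a j i * y i)"
      using fun_cong[OF xy(4), of j] j by (simp add: \<phi>_def)
    then show "(\<Sum>i\<in>I. a j i * (x i - y i)) = 0"
      by (simp add: right_diff_distrib sum_subtractf)
  qed
qed

section \<open>Algebraic numbers acting on lattices\<close>

text \<open>
  Arithmetic in a ring of algebraic integers is replaced by a finite set \<open>W\<close> of complex numbers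
  whose integer combinations are stable under multiplication by the numbers in question; such a
  number acts on \<open>W\<close> by an integer matrix. The bound \<open>c\<close> on the row sums of that matrix is
  submultiplicative and subadditive, and it serves as height. The elements of \<open>W\<close> may be linearly
  dependent, so no basis of a number field is ever chosen.
\<close>

definition acts_integrally :: "complex set \<Rightarrow> complex \<Rightarrow> real \<Rightarrow> bool" where
  "acts_integrally W x c \<longleftrightarrow>
     (\<forall>w\<in>W. \<exists>r. x * w = (\<Sum>v\<in>W. of_int (r v) * v) \<and> (\<Sum>v\<in>W. \<bar>real_of_int (r v)\<bar>) \<le> c)"

lemma acts_integrally_mono: "acts_integrally W x c \<Longrightarrow> c \<le> d \<Longrightarrow> acts_integrally W x d"
  unfolding acts_integrally_def by (meson order_trans)

lemma acts_integrally_of_int: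
  assumes "finite W"
  shows "acts_integrally W (of_int k) \<bar>of_int k\<bar>"
  unfolding acts_integrally_def
proof
  fix w assume w: "w \<in> W"
  show "\<exists>r. of_int k * w = (\<Sum>v\<in>W. of_int (r v) * v) \<and> (\<Sum>v\<in>W. \<bar>real_of_int (r v)\<bar>) \<le> \<bar>of_int k\<bar>"
    using assms w
    by (intro exI[of _ "\<lambda>v. if v = w then k else 0"])
       (simp add: if_distrib[of abs] if_distrib[of of_int] if_distrib[of "\<lambda>y. y * _"] cong: if_cong)
qed

lemma acts_integrally_add:
  assumes "acts_integrally W x c" "acts_integrally W y d"
  shows "acts_integrally W (x + y) (c + d)"
  unfolding acts_integrally_def
proof
  fix w assume w: "w \<in> W"
  obtain r where r: "x * w = (\<Sum>v\<in>W. of_int (r v) * v)" "(\<Sum>v\<in>W. \<bar>real_of_int (r v)\<bar>) \<le> c"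
    using assms(1) w unfolding acts_integrally_def by blast
  obtain s where s: "y * w = (\<Sum>v\<in>W. of_int (s v) * v)" "(\<Sum>v\<in>W. \<bar>real_of_int (s v)\<bar>) \<le> d"
    using assms(2) w unfolding acts_integrally_def by blast
  show "\<exists>q. (x + y) * w = (\<Sum>v\<in>W. of_int (q v) * v) \<and> (\<Sum>v\<in>W. \<bar>real_of_int (q v)\<bar>) \<le> c + d"
  proof (intro exI[of _ "\<lambda>v. r v + s v"] conjI)
    show "(x + y) * w = (\<Sum>v\<in>W. of_int (r v + s v) * v)"
      by (simp add: distrib_right sum.distrib r s)
    have "(\<Sum>v\<in>W. \<bar>real_of_int (r v + s v)\<bar>) \<le> (\<Sum>v\<in>W. \<bar>real_of_int (r v)\<bar> + \<bar>real_of_int (s v)\<bar>)"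
      by (intro sum_mono) simp
    also have "\<dots> \<le> c + d" using r s by (simp add: sum.distrib)
    finally show "(\<Sum>v\<in>W. \<bar>real_of_int (r v + s v)\<bar>) \<le> c + d" .
  qed
qed

lemma acts_integrally_mult:
  assumes "acts_integrally W x c" "acts_integrally W y d"
  shows "acts_integrally W (x * y) (c * d)"
  unfolding acts_integrally_def
proof
  fix w assume w: "w \<in> W"
  have "\<forall>v\<in>W. \<exists>r. x * v = (\<Sum>u\<in>W. of_int (r u) * u) \<and> (\<Sum>u\<in>W. \<bar>real_of_int (r u)\<bar>) \<le> c"
    using assms(1) unfolding acts_integrally_def by blast
  then obtain r where r: "\<And>v. v \<in> W \<Longrightarrow> x * v = (\<Sum>u\<in>W. of_int (r v u) * u)"
    "\<And>v. v \<in> W \<Longrightarrow> (\<Sum>u\<in>W. \<bar>real_of_int (r v u)\<bar>) \<le> c" by metis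
  obtain s where s: "y * w = (\<Sum>v\<in>W. of_int (s v) * v)" "(\<Sum>v\<in>W. \<bar>real_of_int (s v)\<bar>) \<le> d"
    using assms(2) w unfolding acts_integrally_def by blast
  have c0: "0 \<le> c" using r(2)[OF w] by (meson abs_ge_zero order_trans sum_nonneg)
  show "\<exists>q. x * y * w = (\<Sum>v\<in>W. of_int (q v) * v) \<and> (\<Sum>v\<in>W. \<bar>real_of_int (q v)\<bar>) \<le> c * d"
  proof (intro exI[of _ "\<lambda>u. \<Sum>v\<in>W. s v * r v u"] conjI)
    have "x * y * w = x * (\<Sum>v\<in>W. of_int (s v) * v)"
      by (simp only: s mult.assoc)
    also have "\<dots> = (\<Sum>v\<in>W. of_int (s v) * (x * v))"
      by (simp add: sum_distrib_left mult.left_commute)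
    also have "\<dots> = (\<Sum>v\<in>W. \<Sum>u\<in>W. of_int (s v * r v u) * u)"
      by (simp add: r sum_distrib_left mult.assoc)
    also have "\<dots> = (\<Sum>u\<in>W. of_int (\<Sum>v\<in>W. s v * r v u) * u)"
      by (subst sum.swap) (simp add: sum_distrib_right)
    finally show "x * y * w = (\<Sum>u\<in>W. of_int (\<Sum>v\<in>W. s v * r v u) * u)" .
    have "(\<Sum>u\<in>W. \<bar>real_of_int (\<Sum>v\<in>W. s v * r v u)\<bar>)
        \<le> (\<Sum>u\<in>W. \<Sum>v\<in>W. \<bar>real_of_int (s v)\<bar> * \<bar>real_of_int (r v u)\<bar>)"
      unfolding of_int_sum of_int_mult abs_mult[symmetric] by (intro sum_mono sum_abs)
    also have "\<dots> = (\<Sum>v\<in>W. \<bar>real_of_int (s v)\<bar> * (\<Sum>u\<in>W. \<bar>real_of_int (r v u)\<bar>))"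
      by (subst sum.swap) (simp add: sum_distrib_left)
    also have "\<dots> \<le> (\<Sum>v\<in>W. \<bar>real_of_int (s v)\<bar> * c)"
      by (intro sum_mono mult_left_mono r) auto
    also have "\<dots> \<le> c * d"
      using mult_right_mono[OF s(2) c0] by (simp only: sum_distrib_right mult.commute[of c d])
    finally show "(\<Sum>u\<in>W. \<bar>real_of_int (\<Sum>v\<in>W. s v * r v u)\<bar>) \<le> c * d" .
  qed
qed

lemma acts_integrally_power:
  assumes "finite W" "acts_integrally W x c"
  shows "acts_integrally W (x ^ n) (c ^ n)"
proof (induction n)
  case 0
  show ?case using acts_integrally_of_int[OF assms(1), of 1] by simp
next
  case (Suc n)
  show ?case using acts_integrally_mult[OF assms(2) Suc] by simp
qed

lemma acts_integrally_sum:
  assumes "finite W" "finite K" "\<And>k. k \<in> K \<Longrightarrow> acts_integrally W (f k) (c k)"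
  shows "acts_integrally W (\<Sum>k\<in>K. f k) (\<Sum>k\<in>K. c k)"
  using assms(2,3)
proof (induction K rule: finite_induct)
  case empty
  show ?case using acts_integrally_of_int[OF assms(1), of 0] by simp
next
  case (insert k K)
  then show ?case by (simp add: acts_integrally_add)
qed

lemma acts_integrally_coordinates:
  assumes "finite W" "1 \<in> W" "acts_integrally W x c"
  obtains r where "x = (\<Sum>v\<in>W. of_int (r v) * v)" "\<And>v. v \<in> W \<Longrightarrow> \<bar>real_of_int (r v)\<bar> \<le> c"
proof -
  obtain r where r: "x * 1 = (\<Sum>v\<in>W. of_int (r v) * v)" "(\<Sum>v\<in>W. \<bar>real_of_int (r v)\<bar>) \<le> c"
    using assms unfolding acts_integrally_def by blast
  have "\<bar>real_of_int (r v)\<bar> \<le> c" if "v \<in> W" for v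
    using member_le_sum[of v W "\<lambda>v. \<bar>real_of_int (r v)\<bar>"] that assms r by simp
  then show ?thesis using that r by simp
qed

text \<open>
  If \<open>1 \<in> W\<close>, the powers of \<open>x\<close> are integer combinations of the \<open>card W\<close> numbers in \<open>W\<close> with
  controlled coefficients, so Siegel's lemma applied to \<open>2 card W\<close> of these coefficient vectors
  yields a polynomial relation. It does the work of the characteristic polynomial.
\<close>

lemma small_integral_relation:
  assumes W: "finite W" "1 \<in> W" and x: "acts_integrally W x c" and c: "1 \<le> c"
  obtains b :: "nat \<Rightarrow> int" where "\<exists>k<2 * card W. b k \<noteq> 0"
    "\<And>k. k < 2 * card W \<Longrightarrow> \<bar>real_of_int (b k)\<bar> \<le> 4 * real (card W) * c ^ (2 * card W)"
    "(\<Sum>k<2 * card W. of_int (b k) * x ^ k) = 0"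
proof -
  define D where "D = card W"
  have D: "0 < D" using W by (auto simp: D_def card_gt_0_iff)
  have "\<exists>r. x ^ k = (\<Sum>v\<in>W. of_int (r v) * v) \<and> (\<forall>v\<in>W. \<bar>real_of_int (r v)\<bar> \<le> c ^ k)" for k
    using acts_integrally_coordinates[OF W acts_integrally_power[OF W(1) x, of k]] by metis
  then obtain r where r: "\<And>k. x ^ k = (\<Sum>v\<in>W. of_int (r k v) * v)"
    "\<And>k v. v \<in> W \<Longrightarrow> \<bar>real_of_int (r k v)\<bar> \<le> c ^ k" by metis
  obtain b where b: "\<exists>k\<in>{..<2 * D}. b k \<noteq> 0"
    "\<And>k. k \<in> {..<2 * D} \<Longrightarrow> \<bar>of_int (b k)\<bar> \<le> 2 * real (card {..<2 * D}) * c ^ (2 * D)"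
    "\<And>v. v \<in> W \<Longrightarrow> (\<Sum>k\<in>{..<2 * D}. r k v * b k) = 0"
  proof (rule siegel[of "{..<2 * D}" W "c ^ (2 * D)" "\<lambda>v k. r k v"])
    show "\<bar>real_of_int (r k v)\<bar> \<le> c ^ (2 * D)" if "v \<in> W" "k \<in> {..<2 * D}" for k v
      using r(2)[OF that(1), of k] power_increasing[of k "2 * D" c] that c by simp
    show "{..<2 * D} \<noteq> {}" using D by (auto simp: lessThan_empty_iff)
  qed (use W c in \<open>auto simp: D_def\<close>)
  have "(\<Sum>k<2 * D. of_int (b k) * x ^ k) = (\<Sum>k<2 * D. \<Sum>v\<in>W. of_int (r k v * b k) * v)"
    by (rule sum.cong) (simp_all only: r(1) sum_distrib_left of_int_mult mult_ac)
  also have "\<dots> = (\<Sum>v\<in>W. of_int (\<Sum>k<2 * D. r k v * b k) * v)"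
    by (subst sum.swap) (simp add: sum_distrib_right)
  also have "\<dots> = 0" using b(3) by simp
  finally show ?thesis using b(1,2) that[of b] by (auto simp: D_def)
qed

text \<open>
  Liouville's inequality. Divide the integral relation by the lowest power of \<open>x\<close> that occurs in
  it: the constant term is then a nonzero integer, hence at least 1 in absolute value, while the
  remaining terms all contain a factor \<open>x\<close>.
\<close>

lemma liouville_lower_bound:
  assumes W: "finite W" "1 \<in> W" and x: "acts_integrally W x c" and c: "1 \<le> c" and "x \<noteq> 0"
  shows "1 \<le> norm x * (8 * real (card W) ^ 2 * c ^ (2 * card W))"
proof -
  define D where "D = card W"
  define M where "M = 4 * real D * c ^ (2 * D)"
  have D: "1 \<le> D" using W by (auto simp: D_def card_gt_0_iff Suc_le_eq)
  obtain b :: "nat \<Rightarrow> int" where b: "\<exists>k<2 * D. b k \<noteq> 0"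
    "\<And>k. k < 2 * D \<Longrightarrow> \<bar>real_of_int (b k)\<bar> \<le> M"
    "(\<Sum>k<2 * D. of_int (b k) * x ^ k) = 0"
    unfolding D_def M_def by (rule small_integral_relation[OF W x c]) blast
  have "1 \<le> 4 * real D" using D by simp
  then have M: "1 \<le> M" unfolding M_def using mult_mono[of 1 "4 * real D" 1 "c ^ (2 * D)"] c by simp
  have goal: "8 * real D ^ 2 * c ^ (2 * D) = real (2 * D) * M"
    by (simp add: M_def power2_eq_square)
  show ?thesis
  proof (cases "norm x \<ge> 1")
    case True
    have "1 \<le> real (2 * D) * M" using mult_mono[of 1 "real (2 * D)" 1 M] D M by simp
    then show ?thesis using True mult_mono[of 1 "norm x" 1 "real (2 * D) * M"]
      by (simp add: goal[unfolded D_def] D_def)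
  next
    case False
    define k0 where "k0 = (LEAST k. b k \<noteq> 0)"
    obtain k where k: "k < 2 * D" "b k \<noteq> 0" using b(1) by blast
    have k0: "b k0 \<noteq> 0" unfolding k0_def using k(2) by (rule LeastI)
    have k0k: "k0 \<le> k" unfolding k0_def using k(2) by (rule Least_le)
    have below: "b l = 0" if "l < k0" for l using not_less_Least that unfolding k0_def by blast
    have "(\<Sum>l<2 * D. of_int (b l) * x ^ l)
        = of_int (b k0) * x ^ k0 + (\<Sum>l\<in>{..<2 * D} - {k0}. of_int (b l) * x ^ l)"
      using k k0k by (intro sum.remove) auto
    then have eq: "of_int (b k0) * x ^ k0 = - (\<Sum>l\<in>{..<2 * D} - {k0}. of_int (b l) * x ^ l)"
      using b(3) by (simp add: eq_neg_iff_add_eq_0)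
    have "norm x ^ k0 \<le> norm (of_int (b k0) * x ^ k0)"
    proof -
      have "1 \<le> \<bar>b k0\<bar>" using k0 by linarith
      then have "1 \<le> \<bar>real_of_int (b k0)\<bar>" by linarith
      then show ?thesis using mult_right_mono[of 1 "\<bar>real_of_int (b k0)\<bar>" "norm x ^ k0"]
        by (simp add: norm_mult norm_power)
    qed
    also have "\<dots> \<le> (\<Sum>l\<in>{..<2 * D} - {k0}. norm (of_int (b l) * x ^ l))"
      unfolding eq norm_minus_cancel by (rule norm_sum)
    also have "\<dots> \<le> (\<Sum>l\<in>{..<2 * D} - {k0}. M * norm x ^ Suc k0)"
    proof (rule sum_mono)
      fix l assume l: "l \<in> {..<2 * D} - {k0}"
      show "norm (of_int (b l) * x ^ l) \<le> M * norm x ^ Suc k0"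
      proof (cases "l < k0")
        case True
        then show ?thesis using below M by simp
      next
        case False
        then have "Suc k0 \<le> l" using l by auto
        then have "norm x ^ l \<le> norm x ^ Suc k0"
          using \<open>\<not> norm x \<ge> 1\<close> by (intro power_decreasing) auto
        then show ?thesis unfolding norm_mult norm_power
          using b(2)[of l] l M by (intro mult_mono) auto
      qed
    qed
    also have "\<dots> \<le> (\<Sum>l\<in>{..<2 * D}. M * norm x ^ Suc k0)"
      using M by (intro sum_mono2) auto
    also have "\<dots> = norm x ^ k0 * (norm x * (real (2 * D) * M))" by simp
    finally have "1 \<le> norm x * (real (2 * D) * M)" using \<open>x \<noteq> 0\<close> by simp
    then show ?thesis by (simp add: goal[unfolded D_def] D_def)
  qed
qed

lemma acts_integrally_imp_algebraic:
  assumes W: "finite W" "1 \<in> W" and x: "acts_integrally W x c" and c: "1 \<le> c"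
  shows "algebraic x"
proof -
  obtain b :: "nat \<Rightarrow> int" where b: "\<exists>k<2 * card W. b k \<noteq> 0"
    "(\<Sum>k<2 * card W. of_int (b k) * x ^ k) = 0"
    by (rule small_integral_relation[OF W x c]) blast
  define p where "p = (\<Sum>k<2 * card W. monom (of_int (b k)) k :: complex poly)"
  have cf: "coeff p k = (if k < 2 * card W then of_int (b k) else 0)" for k
    by (simp add: p_def coeff_sum)
  show ?thesis
  proof (rule algebraicI)
    show "coeff p k \<in> \<int>" for k by (simp add: cf)
    show "p \<noteq> 0" using b(1) cf by (metis coeff_0 of_int_eq_0_iff)
    show "poly p x = 0" using b(2) by (simp add: p_def poly_sum poly_monom)
  qed
qed

text \<open>
  If \<open>a\<close> is the leading coefficient of an integer polynomial of degree \<open>d\<close> vanishing at \<open>x\<close>,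
  then multiplying the equation by \<open>a ^ (d - 1)\<close> makes it monic in \<open>a x\<close>.
\<close>

lemma algebraic_int_multiple:
  fixes x :: complex
  assumes "algebraic x"
  obtains q :: int where "0 < q" "algebraic_int (of_int q * x)"
proof -
  obtain p where p: "\<And>i. coeff p i \<in> \<int>" "p \<noteq> 0" "poly p x = 0"
    using assms by (rule algebraicE) blast
  define d where "d = degree p"
  define a where "a = lead_coeff p"
  have a: "a \<in> \<int>" "a \<noteq> 0" using p by (auto simp: a_def)
  have d: "0 < d"
  proof (rule ccontr)
    assume "\<not> 0 < d"
    then obtain c where "p = [:c:]" using degree_eq_zeroE[of p] by (auto simp: d_def)
    then show False using p by simp
  qed
  define Q where "Q = monom 1 d + (\<Sum>i<d. monom (coeff p i * a ^ (d - Suc i)) i)"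
  have cf: "coeff Q k = (if k = d then 1 else if k < d then coeff p k * a ^ (d - Suc k) else 0)" for k
    by (simp add: Q_def coeff_sum)
  have deg: "degree Q = d"
    by (rule antisym[OF degree_le le_degree]) (auto simp: cf)
  have "algebraic_int (a * x)"
  proof (rule algebraic_int.intros)
    show "lead_coeff Q = 1" by (simp add: deg cf)
    show "\<forall>i. coeff Q i \<in> \<int>" using p(1) a(1) by (auto simp: cf)
    have "poly Q (a * x) = a ^ d * x ^ d + (\<Sum>i<d. coeff p i * a ^ (d - Suc i) * (a * x) ^ i)"
      by (simp add: Q_def poly_monom poly_sum power_mult_distrib)
    also have "(\<Sum>i<d. coeff p i * a ^ (d - Suc i) * (a * x) ^ i)
        = (\<Sum>i<d. a ^ (d - 1) * (coeff p i * x ^ i))"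
    proof (rule sum.cong[OF refl])
      fix i assume "i \<in> {..<d}"
      then have "d - 1 = (d - Suc i) + i" by auto
      then show "coeff p i * a ^ (d - Suc i) * (a * x) ^ i = a ^ (d - 1) * (coeff p i * x ^ i)"
        by (simp only: power_add power_mult_distrib mult_ac)
    qed
    also have "a ^ d * x ^ d = a ^ (d - 1) * (coeff p d * x ^ d)"
      using d by (cases d) (simp_all add: a_def d_def)
    also have "a ^ (d - 1) * (coeff p d * x ^ d) + (\<Sum>i<d. a ^ (d - 1) * (coeff p i * x ^ i))
        = a ^ (d - 1) * (\<Sum>i\<le>d. coeff p i * x ^ i)"
      by (simp add: lessThan_Suc_atMost[symmetric] distrib_left sum_distrib_left)
    also have "\<dots> = 0" using p(3) by (simp add: poly_altdef d_def)
    finally show "poly Q (a * x) = 0" .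
  qed
  moreover obtain l :: int where l: "a = of_int l" using a(1) by (auto elim: Ints_cases)
  ultimately have "algebraic_int (of_int \<bar>l\<bar> * x)"
    by (cases "0 \<le> l") auto
  then show ?thesis using that[of "\<bar>l\<bar>"] a l by auto
qed

definition int_span :: "complex set \<Rightarrow> complex set" where
  "int_span W = range (\<lambda>r. \<Sum>v\<in>W. of_int (r v) * v)"

lemma int_spanI: "x = (\<Sum>v\<in>W. of_int (r v) * v) \<Longrightarrow> x \<in> int_span W"
  by (simp add: int_span_def)

lemma int_span_base: "finite W \<Longrightarrow> w \<in> W \<Longrightarrow> w \<in> int_span W"
  by (rule int_spanI[of _ "\<lambda>v. if v = w then 1 else 0"])
     (simp add: if_distrib[of of_int] if_distrib[of "\<lambda>y. y * _"] cong: if_cong)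

lemma int_span_add: "x \<in> int_span W \<Longrightarrow> y \<in> int_span W \<Longrightarrow> x + y \<in> int_span W"
proof -
  assume "x \<in> int_span W" "y \<in> int_span W"
  then obtain r s where "x = (\<Sum>v\<in>W. of_int (r v) * v)" "y = (\<Sum>v\<in>W. of_int (s v) * v)"
    unfolding int_span_def by blast
  then have "x + y = (\<Sum>v\<in>W. of_int (r v + s v) * v)"
    by (simp add: distrib_right sum.distrib)
  then show ?thesis by (rule int_spanI)
qed

lemma int_span_scale: "x \<in> int_span W \<Longrightarrow> k \<in> \<int> \<Longrightarrow> k * x \<in> int_span W"
proof -
  assume "x \<in> int_span W" "k \<in> \<int>"
  then obtain r l where "x = (\<Sum>v\<in>W. of_int (r v) * v)" "k = of_int l"
    unfolding int_span_def by (blast elim: Ints_cases)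
  then have "k * x = (\<Sum>v\<in>W. of_int (l * r v) * v)"
    by (simp add: sum_distrib_left mult.assoc)
  then show ?thesis by (rule int_spanI)
qed

lemma int_span_sum: "(\<And>i. i \<in> I \<Longrightarrow> f i \<in> int_span W) \<Longrightarrow> (\<Sum>i\<in>I. f i) \<in> int_span W"
proof (induction I rule: infinite_finite_induct)
  case (insert x F)
  then show ?case by (simp add: int_span_add)
next
  case empty
  have "0 = (\<Sum>v\<in>W. of_int ((\<lambda>_. 0) v) * v)" by simp
  then show ?case unfolding sum.empty by (rule int_spanI)
next
  case (infinite A)
  have "0 = (\<Sum>v\<in>W. of_int ((\<lambda>_. 0) v) * v)" by simp
  then show ?case unfolding sum.infinite[OF infinite(1)] by (rule int_spanI)
qed

lemma acts_integrally_if_stable: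
  assumes W: "finite W" and x: "\<And>w. w \<in> W \<Longrightarrow> x * w \<in> int_span W"
  obtains c where "1 \<le> c" "acts_integrally W x c"
proof -
  have "\<forall>w\<in>W. \<exists>r. x * w = (\<Sum>v\<in>W. of_int (r v) * v)"
    using x unfolding int_span_def by blast
  then obtain r where r: "\<And>w. w \<in> W \<Longrightarrow> x * w = (\<Sum>v\<in>W. of_int (r w v) * v)" by metis
  define c where "c = 1 + (\<Sum>w\<in>W. \<Sum>v\<in>W. \<bar>real_of_int (r w v)\<bar>)"
  have "(\<Sum>v\<in>W. \<bar>real_of_int (r w v)\<bar>) \<le> c" if "w \<in> W" for w
    using member_le_sum[of w W "\<lambda>w. \<Sum>v\<in>W. \<bar>real_of_int (r w v)\<bar>"] that W
    by (simp add: c_def sum_nonneg)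
  then have "acts_integrally W x c" unfolding acts_integrally_def using r by blast
  moreover have "1 \<le> c" by (simp add: c_def sum_nonneg)
  ultimately show ?thesis using that by blast
qed

text \<open>
  The monic equation of \<open>x\<close> reduces the only product \<open>x * x ^ (d - 1)\<close> that leaves the list of
  powers. The factor \<open>m\<close> is carried along so that the reduction also applies to
  monomials in several algebraic integers.
\<close>

lemma algebraic_int_powers_stable:
  assumes "algebraic_int x"
  obtains d where "0 < d"
    "\<And>M i m. finite M \<Longrightarrow> i < d \<Longrightarrow> m \<in> M \<Longrightarrow>
       x * (x ^ i * m) \<in> int_span ((\<lambda>(i, m). x ^ i * m) ` ({..<d} \<times> M))"
proof -
  obtain p where p: "lead_coeff p = 1" "\<And>i. coeff p i \<in> \<int>" "poly p x = 0"
    using assms by (auto simp: algebraic_int.simps)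
  define d where "d = degree p"
  have d: "0 < d"
  proof (rule ccontr)
    assume "\<not> 0 < d"
    then obtain c where "p = [:c:]" using degree_eq_zeroE[of p] by (auto simp: d_def)
    then show False using p by simp
  qed
  have "0 = (\<Sum>i<d. coeff p i * x ^ i) + x ^ d"
    using p(1,3) unfolding poly_altdef d_def[symmetric]
    by (simp add: lessThan_Suc_atMost[symmetric])
  then have xd: "x ^ d = (\<Sum>i<d. - coeff p i * x ^ i)"
    by (simp add: sum_negf eq_neg_iff_add_eq_0 add.commute)
  show ?thesis
  proof (rule that[OF d])
    fix M :: "complex set" and i m assume M: "finite M" "i < d" "m \<in> M"
    let ?W = "(\<lambda>(i, m). x ^ i * m) ` ({..<d} \<times> M)"
    have base: "x ^ j * m \<in> int_span ?W" if "j < d" for j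
      by (rule int_span_base) (use M that in auto)
    show "x * (x ^ i * m) \<in> int_span ?W"
    proof (cases "Suc i < d")
      case True
      then show ?thesis using base[of "Suc i"] by (simp add: mult.assoc)
    next
      case False
      then have "d = Suc i" using M by auto
      then have "x * (x ^ i * m) = x ^ d * m" by simp
      also have "\<dots> = (\<Sum>j<d. - coeff p j * (x ^ j * m))"
        unfolding xd by (simp add: sum_distrib_right mult.assoc)
      also have "\<dots> \<in> int_span ?W"
        by (intro int_span_sum int_span_scale base) (use p(2) in auto)
      finally show ?thesis .
    qed
  qed
qed

text \<open>
  The monomials in \<open>x\<close>, \<open>y\<close>, \<open>z\<close> with exponents below the degrees span a lattice on which all
  three numbers act.
\<close>

lemma common_lattice_algebraic_int:
  assumes "algebraic_int x" "algebraic_int y" "algebraic_int z"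
  obtains W c where "finite W" "1 \<in> W" "1 \<le> c"
    "acts_integrally W x c" "acts_integrally W y c" "acts_integrally W z c"
proof -
  obtain d where d: "0 < d" "\<And>M i m. finite M \<Longrightarrow> i < d \<Longrightarrow> m \<in> M \<Longrightarrow>
       x * (x ^ i * m) \<in> int_span ((\<lambda>(i, m). x ^ i * m) ` ({..<d} \<times> M))"
    using algebraic_int_powers_stable[OF assms(1)] by blast
  obtain e where e: "0 < e" "\<And>M i m. finite M \<Longrightarrow> i < e \<Longrightarrow> m \<in> M \<Longrightarrow>
       y * (y ^ i * m) \<in> int_span ((\<lambda>(i, m). y ^ i * m) ` ({..<e} \<times> M))"
    using algebraic_int_powers_stable[OF assms(2)] by blast
  obtain f where f: "0 < f" "\<And>M i m. finite M \<Longrightarrow> i < f \<Longrightarrow> m \<in> M \<Longrightarrow>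
       z * (z ^ i * m) \<in> int_span ((\<lambda>(i, m). z ^ i * m) ` ({..<f} \<times> M))"
    using algebraic_int_powers_stable[OF assms(3)] by blast
  define W where "W = {x ^ i * (y ^ j * z ^ k) | i j k. i < d \<and> j < e \<and> k < f}"
  \<comment> \<open>The same set of monomials, with one variable singled out.\<close>
  have split: "{g i j k | i j k. i < a \<and> j < b \<and> k < l}
      = (\<lambda>(i, m). u ^ i * m) ` ({..<a} \<times> {h j k | j k. j < b \<and> k < l})"
    if "\<And>i j k. g i j k = u ^ i * h j k" for g h and u :: complex and a b l :: nat
    unfolding that by (auto simp: image_iff) blast
  have perm: "W = {x ^ i * (y ^ j * z ^ k) | j i k. j < e \<and> i < d \<and> k < f}"
    "W = {x ^ i * (y ^ j * z ^ k) | k i j. k < f \<and> i < d \<and> j < e}"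
    unfolding W_def by blast+
  have Wx: "W = (\<lambda>(i, m). x ^ i * m) ` ({..<d} \<times> {y ^ j * z ^ k | j k. j < e \<and> k < f})"
    unfolding W_def by (rule split) simp
  have Wy: "W = (\<lambda>(j, m). y ^ j * m) ` ({..<e} \<times> {x ^ i * z ^ k | i k. i < d \<and> k < f})"
    unfolding perm(1) by (rule split) (simp add: mult_ac)
  have Wz: "W = (\<lambda>(k, m). z ^ k * m) ` ({..<f} \<times> {x ^ i * y ^ j | i j. i < d \<and> j < e})"
    unfolding perm(2) by (rule split) (simp add: mult_ac)
  have fin: "finite {g i j | i j. i < m \<and> j < n}" for g :: "nat \<Rightarrow> nat \<Rightarrow> complex" and m n
  proof -
    have "{g i j | i j. i < m \<and> j < n} = (\<lambda>(i, j). g i j) ` ({..<m} \<times> {..<n})" by auto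
    then show ?thesis by simp
  qed
  have finW: "finite W" unfolding Wx by (intro finite_imageI finite_cartesian_product fin) simp
  have "1 = x ^ 0 * (y ^ 0 * z ^ 0)" by simp
  then have oneW: "1 \<in> W" unfolding W_def using d(1) e(1) f(1) by blast
  have "x * w \<in> int_span W" if "w \<in> W" for w
    using that unfolding Wx by (auto intro!: d(2) fin)
  then obtain c1 where c1: "1 \<le> c1" "acts_integrally W x c1"
    using acts_integrally_if_stable[OF finW] by metis
  have "y * w \<in> int_span W" if "w \<in> W" for w
    using that unfolding Wy by (auto intro!: e(2) fin)
  then obtain c2 where c2: "1 \<le> c2" "acts_integrally W y c2"
    using acts_integrally_if_stable[OF finW] by metis
  have "z * w \<in> int_span W" if "w \<in> W" for w
    using that unfolding Wz by (auto intro!: f(2) fin)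
  then obtain c3 where c3: "1 \<le> c3" "acts_integrally W z c3"
    using acts_integrally_if_stable[OF finW] by metis
  show ?thesis
    by (rule that[of W "c1 + c2 + c3", OF finW oneW])
       (use c1 c2 c3 in \<open>auto intro: acts_integrally_mono\<close>)
qed

lemma common_lattice:
  assumes "algebraic x" "algebraic y" "algebraic z"
  obtains W c q where "finite W" "1 \<in> W" "1 \<le> c" "0 < q"
    "acts_integrally W (of_int q * x) c" "acts_integrally W (of_int q * y) c"
    "acts_integrally W (of_int q * z) c"
proof -
  obtain q1 where q1: "0 < q1" "algebraic_int (of_int q1 * x)"
    using algebraic_int_multiple[OF assms(1)] .
  obtain q2 where q2: "0 < q2" "algebraic_int (of_int q2 * y)"
    using algebraic_int_multiple[OF assms(2)] .
  obtain q3 where q3: "0 < q3" "algebraic_int (of_int q3 * z)"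
    using algebraic_int_multiple[OF assms(3)] .
  obtain W c where W: "finite W" "1 \<in> W" "1 \<le> c" "acts_integrally W (of_int q1 * x) c"
    "acts_integrally W (of_int q2 * y) c" "acts_integrally W (of_int q3 * z) c"
    using common_lattice_algebraic_int[OF q1(2) q2(2) q3(2)] .
  define q where "q = q1 * q2 * q3"
  have scale: "acts_integrally W (of_int q * u) (real_of_int q * c)"
    if "acts_integrally W (of_int a * u) c" "q = b * a" "0 < b" "0 < a" for a b u
  proof -
    have "acts_integrally W (of_int b * (of_int a * u)) (\<bar>of_int b\<bar> * c)"
      by (rule acts_integrally_mult[OF acts_integrally_of_int[OF W(1)] that(1)])
    moreover have "\<bar>real_of_int b\<bar> * c \<le> real_of_int q * c"
      using that W(3) by (intro mult_right_mono) auto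
    ultimately show ?thesis using that(2) by (auto simp: mult.assoc intro: acts_integrally_mono)
  qed
  have q: "0 < q" using q1 q2 q3 by (simp add: q_def)
  then have "1 \<le> real_of_int q" by linarith
  then have "1 \<le> real_of_int q * c" using W(3) mult_mono[of 1 "real_of_int q" 1 c] by simp
  then show ?thesis
    using that[OF W(1,2) _ q] scale[OF W(4), of "q2 * q3"] scale[OF W(5), of "q1 * q3"]
      scale[OF W(6), of "q1 * q2"] q1 q2 q3 by (simp add: q_def mult_ac)
qed

lemma algebraic_cancel_of_int:
  fixes x :: complex
  assumes "algebraic (of_int k * x)" "k \<noteq> 0"
  shows "algebraic x"
proof -
  obtain p where p: "\<And>i. coeff p i \<in> \<int>" "p \<noteq> 0" "poly p (of_int k * x) = 0"
    using assms(1) by (rule algebraicE) blast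
  show ?thesis
  proof (rule algebraicI)
    show "coeff (pcompose p [:0, of_int k:]) i \<in> \<int>" for i
      using p(1) by (simp add: coeff_pcompose_linear)
    show "pcompose p [:0, of_int k:] \<noteq> 0" using p(2) assms(2) by (simp add: pcompose_eq_0_iff)
    show "poly (pcompose p [:0, of_int k:]) x = 0" using p(3) by (simp add: poly_pcompose mult.commute)
  qed
qed

text \<open>
  A sum or product of numbers acting on a common lattice acts on it, and every number that does so
  is algebraic by the integral relation between its powers.
\<close>

lemma
  fixes x y :: complex
  assumes "algebraic x" "algebraic y"
  shows algebraic_add: "algebraic (x + y)" and algebraic_mult: "algebraic (x * y)"
proof -
  obtain W c q where W: "finite W" "1 \<in> W" "1 \<le> c" "0 < q"
    "acts_integrally W (of_int q * x) c" "acts_integrally W (of_int q * y) c"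
    using common_lattice[OF assms assms(1)] by metis
  have "acts_integrally W (of_int q * (x + y)) (c + c)"
    using acts_integrally_add[OF W(5,6)] by (simp add: distrib_left)
  then show "algebraic (x + y)"
    using acts_integrally_imp_algebraic[OF W(1,2), of _ "c + c"] W(3,4)
    by (auto intro: algebraic_cancel_of_int[of q])
  have "acts_integrally W (of_int (q * q) * (x * y)) (c * c)"
    using acts_integrally_mult[OF W(5,6)] by (simp add: mult_ac)
  moreover have "1 \<le> c * c" using W(3) mult_mono[of 1 c 1 c] by simp
  ultimately show "algebraic (x * y)"
    using acts_integrally_imp_algebraic[OF W(1,2)] W(4)
    by (auto intro: algebraic_cancel_of_int[of "q * q"])
qed

section \<open>Functions with many zeros\<close>

lemma factor_zeros:
  assumes F: "F holomorphic_on UNIV" and Z: "finite Z" and zero: "\<And>z. z \<in> Z \<Longrightarrow> F z = 0"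
  obtains G where "G holomorphic_on UNIV" "\<And>w. F w = G w * (\<Prod>z\<in>Z. w - z)"
proof -
  have "\<exists>G. G holomorphic_on UNIV \<and> (\<forall>w. F w = G w * (\<Prod>z\<in>Z. w - z))"
    using Z zero
  proof (induction Z rule: finite_induct)
    case empty
    show ?case using F by auto
  next
    case (insert a Z)
    then obtain G where G: "G holomorphic_on UNIV" "\<And>w. F w = G w * (\<Prod>z\<in>Z. w - z)"
      by auto
    have "(\<Prod>z\<in>Z. a - z) \<noteq> 0" using insert.hyps by auto
    moreover have "F a = 0" using insert.prems by simp
    ultimately have Ga: "G a = 0" using G(2)[of a] by simp
    let ?G = "\<lambda>w. if w = a then deriv G a else (G w - G a) / (w - a)"
    have "?G holomorphic_on UNIV" by (rule pole_lemma_open[OF G(1)]) simp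
    moreover have "F w = ?G w * (\<Prod>z\<in>insert a Z. w - z)" for w
      using insert.hyps Ga G(2)[of w] by simp
    ultimately show ?case by blast
  qed
  then show ?thesis using that by blast
qed

text \<open>
  A function with many zeros in a disc is very small there: dividing by the linear factors and
  applying the maximum principle on a circle seven times as large, each zero contributes a factor
  \<open>3 r / (6 r)\<close>.
\<close>

lemma schwarz_many_zeros:
  assumes F: "F holomorphic_on UNIV" and Z: "finite Z" "Z \<subseteq> cball 0 r" and r: "0 < r"
    and zero: "\<And>z. z \<in> Z \<Longrightarrow> F z = 0"
    and M: "\<And>u. norm u = 7 * r \<Longrightarrow> norm (F u) \<le> M" and w: "norm w \<le> 2 * r"
  shows "norm (F w) \<le> M / 2 ^ card Z"
proof -
  obtain G where G: "G holomorphic_on UNIV" "\<And>w. F w = G w * (\<Prod>z\<in>Z. w - z)"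
    using factor_zeros[OF F Z(1) zero] by blast
  have lower: "(6 * r) ^ card Z \<le> norm (\<Prod>z\<in>Z. u - z)" if "norm u = 7 * r" for u
  proof -
    have "(\<Prod>z\<in>Z. 6 * r) \<le> (\<Prod>z\<in>Z. norm (u - z))"
    proof (rule prod_mono)
      fix z assume "z \<in> Z"
      then have "norm z \<le> r" using Z by auto
      then show "0 \<le> 6 * r \<and> 6 * r \<le> norm (u - z)"
        using that r norm_triangle_ineq2[of u z] by auto
    qed
    then show ?thesis by (simp add: prod_norm)
  qed
  have "norm (\<Prod>z\<in>Z. w - z) = (\<Prod>z\<in>Z. norm (w - z))" by (simp add: prod_norm)
  also have "\<dots> \<le> (\<Prod>z\<in>Z. 3 * r)"
  proof (rule prod_mono)
    fix z assume "z \<in> Z"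
    then have "norm z \<le> r" using Z by auto
    then show "0 \<le> norm (w - z) \<and> norm (w - z) \<le> 3 * r"
      using w norm_triangle_ineq4[of w z] by auto
  qed
  finally have upper: "norm (\<Prod>z\<in>Z. w - z) \<le> (3 * r) ^ card Z" by simp
  have M0: "0 \<le> M"
  proof -
    have "norm (of_real (7 * r) :: complex) = 7 * r" using r by (subst norm_of_real) simp
    from order_trans[OF norm_ge_zero M[OF this]] show ?thesis .
  qed
  have Gw: "norm (G w) \<le> M / (6 * r) ^ card Z"
  proof (rule maximum_modulus_frontier[of G "cball 0 (7 * r)"])
    show "G holomorphic_on interior (cball 0 (7 * r))"
      using G(1) holomorphic_on_subset by blast
    show "continuous_on (closure (cball 0 (7 * r))) G"
      using G(1) holomorphic_on_imp_continuous_on continuous_on_subset by blast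
    show "w \<in> cball 0 (7 * r)" using w r by simp
    fix u :: complex assume "u \<in> frontier (cball 0 (7 * r))"
    then have u: "norm u = 7 * r" using r by (simp add: frontier_cball)
    have "norm (G u) * (6 * r) ^ card Z \<le> norm (G u) * norm (\<Prod>z\<in>Z. u - z)"
      by (intro mult_left_mono lower u) auto
    also have "\<dots> \<le> M" using M[OF u] by (simp add: G(2) norm_mult)
    finally show "norm (G u) \<le> M / (6 * r) ^ card Z" using r by (simp add: pos_le_divide_eq)
  qed simp
  have "norm (F w) \<le> M / (6 * r) ^ card Z * (3 * r) ^ card Z"
    unfolding G(2) norm_mult using M0 r by (intro mult_mono Gw upper) auto
  also have "\<dots> = M / 2 ^ card Z"
  proof -
    have "(6 * r) ^ card Z = (2 * (3 * r)) ^ card Z" by simp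
    also have "\<dots> = 2 ^ card Z * (3 * r) ^ card Z" by (rule power_mult_distrib)
    finally have "(6 * r) ^ card Z = 2 ^ card Z * (3 * r) ^ card Z" .
    then show ?thesis using r by simp
  qed
  finally show ?thesis .
qed

text \<open>
  The functions \<open>z\<close> and \<open>exp (\<omega> z)\<close> are algebraically independent: translation by the periods
  of the exponential changes \<open>z\<close> alone, so for fixed \<open>exp (\<omega> z)\<close> the expression is a polynomial
  in \<open>z\<close> with infinitely many roots; its coefficients are polynomials in \<open>exp (\<omega> z)\<close>
  that vanish at every nonzero number.
\<close>

lemma exponential_polynomial_eq_0:
  fixes \<omega> :: complex and p :: "nat \<Rightarrow> nat \<Rightarrow> complex"
  assumes \<omega>: "\<omega> \<noteq> 0"
    and zero: "\<And>z. (\<Sum>i<D1. \<Sum>j<D2. p i j * z ^ i * exp (\<omega> * z) ^ j) = 0"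
    and ij: "i < D1" "j < D2"
  shows "p i j = 0"
proof -
  have poly0: "c k = 0" if "infinite {y. (\<Sum>k<n. c k * y ^ k) = 0}" "k < n"
    for c :: "nat \<Rightarrow> complex" and n k
  proof -
    define P where "P = (\<Sum>k<n. monom (c k) k)"
    have "{y. poly P y = 0} = {y. (\<Sum>k<n. c k * y ^ k) = 0}"
      by (simp add: P_def poly_sum poly_monom)
    then have "P = 0" using that(1) poly_roots_finite[of P] by auto
    moreover have "coeff P k = c k" using that(2) by (simp add: P_def coeff_sum)
    ultimately show ?thesis by simp
  qed
  have row: "(\<Sum>j<D2. p i j * exp (\<omega> * z) ^ j) = 0" for z
  proof (rule poly0[OF _ ij(1)])
    define y where "y k = z + 2 * of_real pi * \<i> * of_nat k / \<omega>" for k :: nat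
    have "inj y" using \<omega> by (auto simp: inj_on_def y_def)
    then have inf: "infinite (range y)" by (simp add: finite_image_iff)
    have "(\<Sum>i<D1. (\<Sum>j<D2. p i j * exp (\<omega> * z) ^ j) * y k ^ i) = 0" for k
    proof -
      have "\<omega> * y k = \<omega> * z + of_nat k * (2 * of_real pi * \<i>)"
        using \<omega> by (simp add: y_def field_simps)
      then have "exp (\<omega> * y k) = exp (\<omega> * z)"
        by (simp add: exp_add exp_of_nat_mult)
      then show ?thesis using zero[of "y k"] by (simp add: sum_distrib_left mult_ac)
    qed
    then have "range y \<subseteq> {y. (\<Sum>i<D1. (\<Sum>j<D2. p i j * exp (\<omega> * z) ^ j) * y ^ i) = 0}" by auto
    then show "infinite {y. (\<Sum>i<D1. (\<Sum>j<D2. p i j * exp (\<omega> * z) ^ j) * y ^ i) = 0}"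
      using inf infinite_super by blast
  qed
  show ?thesis
  proof (rule poly0[OF _ ij(2)])
    have "(\<Sum>j<D2. p i j * w ^ j) = 0" if "w \<noteq> 0" for w
      using row[of "Ln w / \<omega>"] \<omega> that by simp
    then have "- {0} \<subseteq> {y. (\<Sum>j<D2. p i j * y ^ j) = 0}" by auto
    moreover have "infinite (- {0 :: complex})" by (simp add: infinite_UNIV_char_0)
    ultimately show "infinite {y. (\<Sum>j<D2. p i j * y ^ j) = 0}" using infinite_super by blast
  qed
qed

section \<open>The Gelfond-Schneider theorem\<close>

text \<open>
  The choice of parameters for Schneider's method. Degrees \<open>s ^ 3\<close> in \<open>z\<close> and \<open>2 D s\<close> in the
  exponential give \<open>n = 2 D s ^ 4\<close> coefficients, twice the number \<open>D s ^ 4\<close> of equations coming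
  from the \<open>(s\<^sup>2)\<^sup>2\<close> grid points. For \<open>T \<ge> s\<^sup>2\<close> every factor on the left has a logarithm of
  order at most \<open>T * sqrt T * ln T\<close>, which is beaten by the exponent \<open>T\<^sup>2\<close>, the number of zeros.
  On the left, the power of \<open>q\<close> clears denominators, the factor with exponent \<open>2 * D\<close> comes from
  Liouville's inequality, and the last factor bounds the auxiliary function on the large circle.
  The extra factor \<open>T\<close> lets the resulting bound tend to 0.
\<close>

lemma schneider_parameters:
  fixes D :: nat and C q \<rho> K :: real
  assumes D: "1 \<le> D" and C: "1 \<le> C" and q: "1 \<le> q" and \<rho>: "1 \<le> \<rho>" and K: "0 \<le> K"
  obtains s :: nat where "1 \<le> s"
    "\<And>T n A. s\<^sup>2 \<le> T \<Longrightarrow> n = 2 * real D * real s ^ 4 \<Longrightarrow>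
       A = (real T * C) ^ (s ^ 3) * C ^ (2 * T * (2 * D * s)) \<Longrightarrow>
       real T * (q ^ (s ^ 3 + 2 * T * (2 * D * s)) * (8 * real D ^ 2 * (2 * n\<^sup>2 * A\<^sup>2) ^ (2 * D))
         * (2 * n\<^sup>2 * A * (7 * \<rho> * real T) ^ (s ^ 3) * exp (K * real (2 * D * s) * real T)))
       < 2 ^ (T\<^sup>2)"
proof -
  define d where "d = real D"
  \<comment> \<open>The coefficients of \<open>ln x\<close>, \<open>u * ln x\<close>, \<open>u\<close> and 1 in the estimate of the logarithm below.\<close>
  define a1 a2 a3 a4 where
    "a1 = 8 * d + 5"
    and "a2 = 4 * d + 2"
    and "a3 = (1 + 4 * d) * ln q + (4 * d + 1) * (1 + 4 * d) * ln C + ln (7 * \<rho>) + 2 * d * K"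
    and "a4 = ln (8 * d\<^sup>2) + (2 * d + 1) * ln 2 + (4 * d + 2) * ln (2 * d)"
  have "((\<lambda>x::real. ln x / x\<^sup>2) \<longlongrightarrow> 0) at_top" "((\<lambda>x::real. x * sqrt x * ln x / x\<^sup>2) \<longlongrightarrow> 0) at_top"
    "((\<lambda>x::real. x * sqrt x / x\<^sup>2) \<longlongrightarrow> 0) at_top" "((\<lambda>x::real. 1 / x\<^sup>2) \<longlongrightarrow> 0) at_top"
    by real_asymp+
  then have "((\<lambda>x. a1 * (ln x / x\<^sup>2) + a2 * (x * sqrt x * ln x / x\<^sup>2) + a3 * (x * sqrt x / x\<^sup>2)
      + a4 * (1 / x\<^sup>2)) \<longlongrightarrow> a1 * 0 + a2 * 0 + a3 * 0 + a4 * 0) at_top"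
    by (intro tendsto_intros)
  then have "eventually (\<lambda>x. a1 * (ln x / x\<^sup>2) + a2 * (x * sqrt x * ln x / x\<^sup>2)
      + a3 * (x * sqrt x / x\<^sup>2) + a4 * (1 / x\<^sup>2) < ln 2) at_top"
    by (rule order_tendstoD) simp
  then obtain X where X: "\<And>x. X \<le> x \<Longrightarrow> a1 * (ln x / x\<^sup>2) + a2 * (x * sqrt x * ln x / x\<^sup>2)
      + a3 * (x * sqrt x / x\<^sup>2) + a4 * (1 / x\<^sup>2) < ln 2"
    unfolding eventually_at_top_linorder by blast
  define s where "s = max 1 (nat \<lceil>X\<rceil>)"
  have s1: "1 \<le> s" by (simp add: s_def)
  have sX: "X \<le> real s" by (simp add: s_def) linarith
  show ?thesis
  proof (rule that[OF s1])
    fix T :: nat and n A :: real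
    assume T: "s\<^sup>2 \<le> T" and n: "n = 2 * real D * real s ^ 4"
      and A: "A = (real T * C) ^ (s ^ 3) * C ^ (2 * T * (2 * D * s))"
    define x where "x = real T"
    define u where "u = x * sqrt x"
    have "s \<le> s\<^sup>2" using s1 by (simp add: power2_eq_square)
    then have sT: "s \<le> T" and T1: "1 \<le> T" using T s1 by linarith+
    have x1: "1 \<le> x" using T1 by (simp add: x_def)
    have xX: "X \<le> x" using sX sT by (simp add: x_def)
    have sx2: "real s ^ 2 \<le> x" using T unfolding x_def by (metis of_nat_le_iff of_nat_power)
    then have ss: "real s \<le> sqrt x" by (rule real_le_rsqrt)
    have s3: "real s ^ 3 \<le> u"
      using mult_mono[OF sx2 ss] x1 by (simp add: u_def power3_eq_cube power2_eq_square)
    have s4: "real s ^ 4 \<le> x ^ 2"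
      using power_mono[OF sx2, of 2] by (simp flip: power_mult)
    have Ts: "x * real (2 * D * s) \<le> 2 * d * u"
      using mult_left_mono[OF ss, of "2 * d * x"] x1 by (simp add: u_def d_def mult_ac)
    have d1: "1 \<le> d" using D by (simp add: d_def)
    have lns: "0 \<le> ln x" "0 \<le> ln C" "0 \<le> ln q" "0 \<le> ln \<rho>" using x1 C q \<rho> by simp_all
    have ln7: "0 \<le> ln (7 * \<rho>)" using \<rho> by simp
    have n0: "0 < n" using s1 D by (simp add: n)
    have A0: "0 < A" using C T1 by (simp add: A)
    have lnn: "ln n \<le> ln (2 * d) + 2 * ln x"
    proof -
      have "n \<le> 2 * d * x\<^sup>2" using s4 d1 by (simp add: n d_def)
      then have "ln n \<le> ln (2 * d * x\<^sup>2)" using n0 by (subst ln_le_cancel_iff) auto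
      also have "\<dots> = ln (2 * d) + 2 * ln x" using d1 x1 by (simp add: ln_mult ln_realpow)
      finally show ?thesis .
    qed
    have lnA: "ln A \<le> u * (ln C + ln x) + 4 * d * u * ln C"
    proof -
      have "ln A = real s ^ 3 * (ln x + ln C) + 2 * (x * real (2 * D * s)) * ln C"
        using C T1 by (simp add: A ln_mult ln_realpow x_def mult_ac)
      also have "\<dots> \<le> u * (ln x + ln C) + 2 * (2 * d * u) * ln C"
        using lns by (intro add_mono mult_right_mono mult_left_mono s3 Ts) auto
      finally show ?thesis by (simp add: algebra_simps)
    qed
    let ?L = "real T * (q ^ (s ^ 3 + 2 * T * (2 * D * s)) * (8 * real D ^ 2 * (2 * n\<^sup>2 * A\<^sup>2) ^ (2 * D))
         * (2 * n\<^sup>2 * A * (7 * \<rho> * real T) ^ (s ^ 3) * exp (K * real (2 * D * s) * real T)))"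
    have L0: "0 < ?L" using T1 q D n0 A0 \<rho> by simp
    have "ln ?L = ln x + ((real s ^ 3 + 2 * (x * real (2 * D * s))) * ln q
        + (ln (8 * d\<^sup>2) + 2 * d * (ln 2 + 2 * ln n + 2 * ln A))
        + (ln 2 + 2 * ln n + ln A + real s ^ 3 * (ln (7 * \<rho>) + ln x) + K * (x * real (2 * D * s))))"
    proof -
      have "ln (q ^ (s ^ 3 + 2 * T * (2 * D * s))) = (real s ^ 3 + 2 * (x * real (2 * D * s))) * ln q"
        using q by (simp add: ln_realpow x_def)
      moreover have "ln (8 * real D ^ 2 * (2 * n\<^sup>2 * A\<^sup>2) ^ (2 * D))
          = ln (8 * d\<^sup>2) + 2 * d * (ln 2 + 2 * ln n + 2 * ln A)"
        using n0 A0 d1 by (simp add: ln_mult ln_realpow d_def)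
      moreover have "ln (2 * n\<^sup>2 * A * (7 * \<rho> * real T) ^ (s ^ 3) * exp (K * real (2 * D * s) * real T))
          = ln 2 + 2 * ln n + ln A + real s ^ 3 * (ln (7 * \<rho>) + ln x) + K * (x * real (2 * D * s))"
      proof -
        have "0 < n\<^sup>2" using n0 by simp
        then have "ln (2 * n\<^sup>2 * A) = ln 2 + 2 * ln n + ln A"
          using A0 n0 by (simp add: ln_mult_pos ln_realpow)
        moreover have "ln ((7 * \<rho> * real T) ^ (s ^ 3)) = real s ^ 3 * (ln (7 * \<rho>) + ln x)"
          using \<rho> T1 ln_mult_pos[of "7 * \<rho>" "real T"] by (simp add: ln_realpow x_def)
        moreover have "0 < 2 * n\<^sup>2 * A" "0 < (7 * \<rho> * real T) ^ (s ^ 3)"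
          using n0 A0 \<rho> T1 by simp_all
        ultimately show ?thesis
          by (simp only: ln_mult_pos mult_pos_pos exp_gt_zero ln_exp) (simp add: x_def)
      qed
      moreover have "0 < real T" "0 < q ^ (s ^ 3 + 2 * T * (2 * D * s))"
        "0 < 8 * real D ^ 2 * (2 * n\<^sup>2 * A\<^sup>2) ^ (2 * D)"
        "0 < 2 * n\<^sup>2 * A * (7 * \<rho> * real T) ^ (s ^ 3) * exp (K * real (2 * D * s) * real T)"
        using T1 q D n0 A0 \<rho> by simp_all
      ultimately show ?thesis
        by (simp only: ln_mult_pos[of "real T"] ln_mult_pos[of "q ^ _ * _"] ln_mult_pos[of "q ^ _"]
            mult_pos_pos) (simp add: x_def)
    qed
    also have "\<dots> \<le> ln x + ((u + 2 * (2 * d * u)) * ln q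
        + (ln (8 * d\<^sup>2) + 2 * d * (ln 2 + 2 * (ln (2 * d) + 2 * ln x) + 2 * (u * (ln C + ln x) + 4 * d * u * ln C)))
        + (ln 2 + 2 * (ln (2 * d) + 2 * ln x) + (u * (ln C + ln x) + 4 * d * u * ln C)
           + u * (ln (7 * \<rho>) + ln x) + K * (2 * d * u)))"
      using lns ln7 K d1 by (intro add_mono mult_right_mono mult_left_mono s3 Ts lnn lnA order_refl) auto
    also have "\<dots> = a1 * ln x + a2 * (u * ln x) + a3 * u + a4"
      unfolding a1_def a2_def a3_def a4_def by algebra
    also have "\<dots> = (a1 * (ln x / x\<^sup>2) + a2 * (x * sqrt x * ln x / x\<^sup>2)
      + a3 * (x * sqrt x / x\<^sup>2) + a4 * (1 / x\<^sup>2)) * x\<^sup>2"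
      using x1 by (simp add: u_def field_simps)
    also have "\<dots> < ln 2 * x\<^sup>2"
      using X[OF xX] x1 by (intro mult_strict_right_mono) auto
    also have "\<dots> = ln (2 ^ (T\<^sup>2))" by (simp add: ln_realpow x_def)
    finally show "?L < 2 ^ (T\<^sup>2)" using L0 by (subst (asm) ln_less_cancel_iff) auto
  qed
qed

text \<open>
  The values at a grid point of the monomials making up the auxiliary function, with their height.
  The power of \<open>q\<close> suffices to turn each factor \<open>\<beta>\<close>, \<open>x\<close>, \<open>y\<close> into an algebraic integer and is
  the same for all \<open>i\<close>, \<open>j\<close>, so that it can be taken out of their sum.
\<close>

lemma acts_integrally_monomial:
  fixes x y \<beta> :: complex and q :: int and c :: real
  assumes W: "finite W" and q: "0 < q" and c: "1 \<le> c"
    and x: "acts_integrally W (of_int q * x) c" and y: "acts_integrally W (of_int q * y) c"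
    and \<beta>: "acts_integrally W (of_int q * \<beta>) c"
    and bnds: "i \<le> D1" "j \<le> D2" "m \<le> T" "k \<le> T"
  defines "C \<equiv> real_of_int q + c"
  shows "acts_integrally W
    (of_int q ^ (D1 + 2 * T * D2) * ((of_nat m + of_nat k * \<beta>) ^ i * (x ^ m * y ^ k) ^ j))
    ((real T * C) ^ i * C ^ (D1 - i) * C ^ (2 * T * D2))"
proof -
  have qC: "acts_integrally W (of_int q) C"
    by (rule acts_integrally_mono[OF acts_integrally_of_int[OF W]]) (use q c in \<open>auto simp: C_def\<close>)
  have xC: "acts_integrally W (of_int q * x) C" and yC: "acts_integrally W (of_int q * y) C"
    by (rule acts_integrally_mono[OF x], use q in \<open>simp add: C_def\<close>,
        rule acts_integrally_mono[OF y], use q in \<open>simp add: C_def\<close>)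
  have lin: "acts_integrally W (of_int q * (of_nat m + of_nat k * \<beta>)) (real T * C)"
  proof -
    have "acts_integrally W (of_int (q * int m) + of_int (int k) * (of_int q * \<beta>))
        (\<bar>of_int (q * int m)\<bar> + \<bar>of_int (int k)\<bar> * c)"
      by (intro acts_integrally_add acts_integrally_mult acts_integrally_of_int W \<beta>)
    moreover have "\<bar>of_int (q * int m)\<bar> + \<bar>of_int (int k)\<bar> * c \<le> real T * C"
    proof -
      have "real m * real_of_int q \<le> real T * real_of_int q" "real k * c \<le> real T * c"
        using q c bnds by (auto intro!: mult_right_mono)
      moreover have "\<bar>real_of_int (q * int m)\<bar> + \<bar>real_of_int (int k)\<bar> * c = real m * real_of_int q + real k * c"
        using q by (simp add: abs_mult)
      ultimately show ?thesis unfolding C_def distrib_left by linarith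
    qed
    ultimately show ?thesis
      by (auto simp: algebra_simps intro: acts_integrally_mono)
  qed
  have mj: "m * j \<le> T * D2" "k * j \<le> T * D2" using bnds by (auto intro: mult_le_mono)
  define e1 e2 e3 where "e1 = D1 - i" and "e2 = T * D2 - m * j" and "e3 = T * D2 - k * j"
  have e: "D1 = e1 + i" "T * D2 = e2 + m * j" "T * D2 = e3 + k * j"
    using bnds mj by (auto simp: e1_def e2_def e3_def)
  have E: "D1 + 2 * T * D2 = e1 + i + (e2 + m * j) + (e3 + k * j)"
    using e by (simp add: mult_2 distrib_right)
  have split: "of_int q ^ (D1 + 2 * T * D2) * ((of_nat m + of_nat k * \<beta>) ^ i * (x ^ m * y ^ k) ^ j)
      = (of_int q * (of_nat m + of_nat k * \<beta>)) ^ i * of_int q ^ e1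
        * ((of_int q ^ e2 * (of_int q * x) ^ (m * j)) * (of_int q ^ e3 * (of_int q * y) ^ (k * j)))"
    unfolding E by (simp only: power_add power_mult_distrib power_mult[symmetric] mult_ac)
  have C2: "C ^ (2 * T * D2) = (C ^ e2 * C ^ (m * j)) * (C ^ e3 * C ^ (k * j))"
  proof -
    have "2 * T * D2 = (e2 + m * j) + (e3 + k * j)" using E e(1) by simp
    then show ?thesis by (simp add: power_add)
  qed
  show ?thesis
    unfolding split C2 e1_def[symmetric]
    by (intro acts_integrally_mult acts_integrally_power W lin qC xC yC)
qed

text \<open>
  Schneider's proof, which needs no derivatives. An auxiliary function
  \<open>F z = \<Sum>\<^sub>i \<Sum>\<^sub>j p\<^sub>i\<^sub>j z ^ i exp (\<omega> z) ^ j\<close> takes values in a fixed finitely generated ring at the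
  points \<open>m + k \<beta>\<close>, and these are distinct because \<open>\<beta>\<close> is irrational. Siegel's lemma gives small
  integers \<open>p\<^sub>i\<^sub>j\<close>, not all 0, for which \<open>F\<close> vanishes for \<open>m, k < N\<close>. If it vanishes for
  \<open>m, k < T\<close>, it has \<open>T\<^sup>2\<close> zeros in a disc of radius proportional to \<open>T\<close>, so the Schwarz lemma makes
  its values for \<open>m, k \<le> T\<close> too small for Liouville's inequality and they are 0 as well. Hence
  \<open>F\<close> vanishes on the whole grid; applying the Schwarz lemma once more with \<open>T\<close> tending to
  infinity, \<open>F\<close> is identically 0, which contradicts the independence of \<open>z\<close> and \<open>exp (\<omega> z)\<close>.
\<close>

theorem gelfond_schneider:
  fixes \<omega> \<beta> :: complex
  assumes \<omega>: "\<omega> \<noteq> 0" and algx: "algebraic (exp \<omega>)"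
    and alg\<beta>: "algebraic \<beta>" and irrat: "\<beta> \<notin> \<rat>"
  shows "\<not> algebraic (exp (\<beta> * \<omega>))"
proof
  assume algy: "algebraic (exp (\<beta> * \<omega>))"
  define x y where "x = exp \<omega>" and "y = exp (\<beta> * \<omega>)"
  obtain W c q where W: "finite W" "1 \<in> W" and c: "1 \<le> c" and q: "0 < q"
    and acts: "acts_integrally W (of_int q * x) c" "acts_integrally W (of_int q * y) c"
      "acts_integrally W (of_int q * \<beta>) c"
    unfolding x_def y_def by (rule common_lattice[OF algx algy alg\<beta>])
  define D where "D = card W"
  have D: "1 \<le> D" using W by (auto simp: D_def card_gt_0_iff Suc_le_eq)
  define Q C \<rho> K where "Q = real_of_int q" and "C = Q + c" and "\<rho> = 1 + norm \<beta>"
    and "K = 7 * norm \<omega> * \<rho>"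
  have Q: "1 \<le> Q" using q unfolding Q_def by linarith
  have C: "1 \<le> C" using Q c by (simp add: C_def)
  have \<rho>: "1 \<le> \<rho>" by (simp add: \<rho>_def)
  have K: "0 \<le> K" using \<rho> by (simp add: K_def)
  obtain s where s: "1 \<le> s" and param: "\<And>T n A. s\<^sup>2 \<le> T \<Longrightarrow> n = 2 * real D * real s ^ 4 \<Longrightarrow>
       A = (real T * C) ^ (s ^ 3) * C ^ (2 * T * (2 * D * s)) \<Longrightarrow>
       real T * (Q ^ (s ^ 3 + 2 * T * (2 * D * s)) * (8 * real D ^ 2 * (2 * n\<^sup>2 * A\<^sup>2) ^ (2 * D))
         * (2 * n\<^sup>2 * A * (7 * \<rho> * real T) ^ (s ^ 3) * exp (K * real (2 * D * s) * real T)))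
       < 2 ^ (T\<^sup>2)"
    using schneider_parameters[OF D C Q \<rho> K] by blast
  define D1 D2 N where "D1 = s ^ 3" and "D2 = 2 * D * s" and "N = s\<^sup>2"
  define I where "I = {..<D1} \<times> {..<D2}"
  define n where "n = real (card I)"
  define A where "A T = (real T * C) ^ D1 * C ^ (2 * T * D2)" for T
  have N: "1 \<le> N" using s by (simp add: N_def)
  have cI: "card I = 2 * D * s ^ 4"
    by (simp add: I_def D1_def D2_def power_numeral_reduce mult_ac)
  have "1 \<le> card I" using D s by (simp add: cI Suc_le_eq)
  then have n1: "1 \<le> n" by (simp add: n_def)
  have A1: "1 \<le> A T" if "1 \<le> T" for T
  proof -
    have "1 \<le> real T * C" using mult_mono[of 1 "real T" 1 C] that C by simp
    then show ?thesis unfolding A_def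
      using C mult_mono[of 1 "(real T * C) ^ D1" 1 "C ^ (2 * T * D2)"] by simp
  qed
  have A_mono: "A S \<le> A T" if "S \<le> T" for S T
    unfolding A_def using that C by (intro mult_mono power_mono power_increasing) auto
  define mon where "mon i j m k = (of_nat m + of_nat k * \<beta>) ^ i * (x ^ m * y ^ k) ^ j" for i j m k
  have mon: "acts_integrally W (of_int q ^ (D1 + 2 * T * D2) * mon i j m k) (A T)"
    if "(i, j) \<in> I" "m \<le> T" "k \<le> T" "1 \<le> T" for i j m k T
  proof (rule acts_integrally_mono)
    have ij: "i < D1" "j < D2" using that(1) by (auto simp: I_def)
    show "acts_integrally W (of_int q ^ (D1 + 2 * T * D2) * mon i j m k)
        ((real T * C) ^ i * C ^ (D1 - i) * C ^ (2 * T * D2))"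
      unfolding mon_def C_def Q_def
      by (rule acts_integrally_monomial[OF W(1) q c acts]) (use ij that in auto)
    have "C ^ (D1 - i) \<le> (real T * C) ^ (D1 - i)"
      using C that(4) mult_right_mono[of 1 "real T" C] by (intro power_mono) auto
    then have "(real T * C) ^ i * C ^ (D1 - i) \<le> (real T * C) ^ i * (real T * C) ^ (D1 - i)"
      using C by (intro mult_left_mono) auto
    also have "\<dots> = (real T * C) ^ D1" using ij by (simp flip: power_add)
    finally show "(real T * C) ^ i * C ^ (D1 - i) * C ^ (2 * T * D2) \<le> A T"
      unfolding A_def using C by (intro mult_right_mono) auto
  qed
  \<comment> \<open>Each value becomes \<open>D\<close> integer coordinates; asking all of them to vanish is sufficient,
    and it makes the equations integral.\<close>
  define coord where "coord i j m k r \<longleftrightarrow>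
      of_int q ^ (D1 + 2 * N * D2) * mon i j m k = (\<Sum>v\<in>W. of_int (r v) * v)
      \<and> (\<forall>v\<in>W. \<bar>real_of_int (r v)\<bar> \<le> A N)" for i j m k r
  define r where "r i j m k = (SOME r. coord i j m k r)" for i j m k
  have coord: "coord i j m k (r i j m k)" if "(i, j) \<in> I" "m < N" "k < N" for i j m k
  proof -
    have "acts_integrally W (of_int q ^ (D1 + 2 * N * D2) * mon i j m k) (A N)"
      using that N by (intro mon) auto
    then obtain r' where "coord i j m k r'"
      by (rule acts_integrally_coordinates[OF W]) (auto simp: coord_def)
    then show ?thesis unfolding r_def by (rule someI[of "coord i j m k"])
  qed
  have r: "of_int q ^ (D1 + 2 * N * D2) * mon i j m k = (\<Sum>v\<in>W. of_int (r i j m k v) * v)"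
    "v \<in> W \<Longrightarrow> \<bar>real_of_int (r i j m k v)\<bar> \<le> A N"
    if "(i, j) \<in> I" "m < N" "k < N" for i j m k v
    using coord[OF that] by (auto simp: coord_def)
  define J where "J = W \<times> ({..<N} \<times> {..<N})"
  define co where "co = (\<lambda>(v, m, k) (i, j). r i j m k v)"
  obtain p where p: "\<exists>ij\<in>I. p ij \<noteq> 0"
    and pbound: "\<And>ij. ij \<in> I \<Longrightarrow> \<bar>of_int (p ij)\<bar> \<le> 2 * real (card I) * A N"
    and peq: "\<And>vmk. vmk \<in> J \<Longrightarrow> (\<Sum>ij\<in>I. co vmk ij * p ij) = 0"
  proof (rule siegel[of I J "A N" co])
    show "finite I" "finite J" using W by (auto simp: I_def J_def)
    show "I \<noteq> {}" using n1 by (auto simp: n_def)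
    have "card J = D * s ^ 4"
      by (simp add: J_def D_def N_def card_cartesian_product power_numeral_reduce mult_ac)
    then show "2 * card J \<le> card I" by (simp add: cI)
    show "1 \<le> A N" by (rule A1[OF N])
    show "\<bar>real_of_int (co j i)\<bar> \<le> A N" if "j \<in> J" "i \<in> I" for j i
      using that r(2) by (auto simp: co_def J_def split: prod.splits)
  qed blast
  define F where "F z = (\<Sum>i<D1. \<Sum>j<D2. of_int (p (i, j)) * z ^ i * exp (\<omega> * z) ^ j)" for z
  have Fgrid: "F (of_nat m + of_nat k * \<beta>) = (\<Sum>(i, j)\<in>I. of_int (p (i, j)) * mon i j m k)" for m k
  proof -
    have "\<omega> * (of_nat m + of_nat k * \<beta>) = of_nat m * \<omega> + of_nat k * (\<beta> * \<omega>)"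
      by (simp add: algebra_simps)
    then have "exp (\<omega> * (of_nat m + of_nat k * \<beta>)) = x ^ m * y ^ k"
      by (simp add: exp_add exp_of_nat_mult x_def y_def)
    then show ?thesis
      unfolding F_def I_def mon_def by (simp add: sum.cartesian_product mult.assoc)
  qed
  have Fhol: "F holomorphic_on UNIV" unfolding F_def by (intro holomorphic_intros)
  have zeros_N: "F (of_nat m + of_nat k * \<beta>) = 0" if mk: "m < N" "k < N" for m k
  proof -
    have "of_int q ^ (D1 + 2 * N * D2) * F (of_nat m + of_nat k * \<beta>)
        = (\<Sum>(i, j)\<in>I. of_int (p (i, j)) * (of_int q ^ (D1 + 2 * N * D2) * mon i j m k))"
      unfolding Fgrid sum_distrib_left by (intro sum.cong) (auto simp: mult_ac)
    also have "\<dots> = (\<Sum>(i, j)\<in>I. \<Sum>v\<in>W. of_int (co (v, m, k) (i, j) * p (i, j)) * v)"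
    proof (intro sum.cong refl, clarify)
      fix i j assume ij: "(i, j) \<in> I"
      show "of_int (p (i, j)) * (of_int q ^ (D1 + 2 * N * D2) * mon i j m k)
          = (\<Sum>v\<in>W. of_int (co (v, m, k) (i, j) * p (i, j)) * v)"
        unfolding r(1)[OF ij mk] by (simp add: co_def sum_distrib_left mult_ac)
    qed
    also have "\<dots> = (\<Sum>v\<in>W. of_int (\<Sum>ij\<in>I. co (v, m, k) ij * p ij) * v)"
      unfolding split_def by (subst sum.swap) (simp add: sum_distrib_right)
    also have "\<dots> = 0" using peq mk by (simp add: J_def)
    finally show ?thesis using q by simp
  qed
  \<comment> \<open>Height of the values of \<open>F\<close> at grid points with \<open>m, k \<le> T\<close>.\<close>
  define L where "L T = 2 * n\<^sup>2 * (A T)\<^sup>2" for T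
  have L1: "1 \<le> L T" if "1 \<le> T" for T
  proof -
    have "1 \<le> n\<^sup>2" "1 \<le> (A T)\<^sup>2" using n1 A1[OF that] by auto
    then show ?thesis using mult_mono[of 1 "n\<^sup>2" 1 "(A T)\<^sup>2"] by (simp add: L_def)
  qed
  have value_acts: "acts_integrally W (of_int q ^ (D1 + 2 * T * D2) * F (of_nat m + of_nat k * \<beta>)) (L T)"
    if T: "N \<le> T" and mk: "m \<le> T" "k \<le> T" for T m k
  proof (rule acts_integrally_mono)
    have T1: "1 \<le> T" using T N by simp
    have "acts_integrally W (\<Sum>ij\<in>I. of_int (p ij) * (of_int q ^ (D1 + 2 * T * D2) * mon (fst ij) (snd ij) m k))
        (\<Sum>ij\<in>I. \<bar>of_int (p ij)\<bar> * A T)"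
      by (intro acts_integrally_sum acts_integrally_mult acts_integrally_of_int mon W)
         (use mk T1 in \<open>auto simp: I_def\<close>)
    also have "(\<Sum>ij\<in>I. of_int (p ij) * (of_int q ^ (D1 + 2 * T * D2) * mon (fst ij) (snd ij) m k))
        = of_int q ^ (D1 + 2 * T * D2) * F (of_nat m + of_nat k * \<beta>)"
      unfolding Fgrid sum_distrib_left by (intro sum.cong) (auto simp: mult_ac)
    finally show "acts_integrally W (of_int q ^ (D1 + 2 * T * D2) * F (of_nat m + of_nat k * \<beta>))
        (\<Sum>ij\<in>I. \<bar>of_int (p ij)\<bar> * A T)" .
    have "(\<Sum>ij\<in>I. \<bar>of_int (p ij)\<bar> * A T) \<le> (\<Sum>ij\<in>I. 2 * n * A N * A T)"
      unfolding n_def using A1[OF T1] by (intro sum_mono mult_right_mono pbound) auto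
    also have "\<dots> = 2 * n\<^sup>2 * (A N * A T)" by (simp add: n_def power2_eq_square)
    also have "\<dots> \<le> L T"
      unfolding L_def power2_eq_square[of "A T"] using A1[OF T1] A_mono[OF T]
      by (intro mult_left_mono mult_right_mono) auto
    finally show "(\<Sum>ij\<in>I. \<bar>of_int (p ij)\<bar> * A T) \<le> L T" .
  qed
  \<comment> \<open>Bound for \<open>F\<close> on the circle of radius \<open>7 \<rho> T\<close>.\<close>
  define B where "B T = 2 * n\<^sup>2 * A T * (7 * \<rho> * real T) ^ D1 * exp (K * real D2 * real T)" for T
  have inj: "inj (\<lambda>(m, k). of_nat m + of_nat k * \<beta>)"
  proof (rule injI, clarsimp)
    fix m k m' k' :: nat
    assume eq: "of_nat m + of_nat k * \<beta> = of_nat m' + of_nat k' * \<beta>"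
    have "k = k'"
    proof (rule ccontr)
      assume "k \<noteq> k'"
      then have "(of_nat k - of_nat k' :: complex) \<noteq> 0" by simp
      moreover have "(of_nat k - of_nat k') * \<beta> = of_nat m' - of_nat m"
        using eq by (simp add: algebra_simps)
      ultimately have "\<beta> = (of_nat m' - of_nat m) / (of_nat k - of_nat k')"
        by (simp add: field_simps)
      then show False using irrat by simp
    qed
    then show "m = m' \<and> k = k'" using eq by simp
  qed
  have grid_norm: "norm (of_nat m + of_nat k * \<beta>) \<le> real T * \<rho>" if "m \<le> T" "k \<le> T" for m k T
  proof -
    have "norm (of_nat m + of_nat k * \<beta>) \<le> real m + real k * norm \<beta>"
      using norm_triangle_ineq[of "of_nat m" "of_nat k * \<beta>"] by (simp add: norm_mult)
    also have "\<dots> \<le> real T + real T * norm \<beta>"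
      using that by (intro add_mono mult_right_mono) auto
    finally show ?thesis by (simp add: \<rho>_def algebra_simps)
  qed
  have small: "norm (F w) \<le> B T / 2 ^ (T\<^sup>2)"
    if T: "N \<le> T" and zeros: "\<And>m k. m < T \<Longrightarrow> k < T \<Longrightarrow> F (of_nat m + of_nat k * \<beta>) = 0"
      and w: "norm w \<le> 2 * (real T * \<rho>)" for T w
  proof -
    have T1: "1 \<le> T" using T N by simp
    define Z where "Z = (\<lambda>(m, k). of_nat m + of_nat k * \<beta>) ` ({..<T} \<times> {..<T})"
    have cZ: "card Z = T\<^sup>2"
      unfolding Z_def by (subst card_image) (auto intro: inj_on_subset[OF inj] simp: power2_eq_square)
    have "norm (F w) \<le> B T / 2 ^ card Z"
    proof (rule schwarz_many_zeros[OF Fhol _ _ _ _ _ w])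
      show "finite Z" by (simp add: Z_def)
      show "Z \<subseteq> cball 0 (real T * \<rho>)"
        unfolding Z_def using grid_norm by (auto intro: less_imp_le)
      show "0 < real T * \<rho>" using T1 \<rho> by simp
      show "F z = 0" if "z \<in> Z" for z using that zeros by (auto simp: Z_def)
      fix u :: complex assume u: "norm u = 7 * (real T * \<rho>)"
      have "1 \<le> real T * \<rho>" using T1 \<rho> mult_mono[of 1 "real T" 1 \<rho>] by simp
      then have u1: "1 \<le> norm u" using u by simp
      have e: "norm (exp (\<omega> * u)) \<le> exp (norm \<omega> * norm u)"
        using norm_exp[of "\<omega> * u"] by (simp add: norm_mult)
      have "norm (F u) \<le> (\<Sum>ij\<in>I. norm (of_int (p ij) * u ^ fst ij * exp (\<omega> * u) ^ snd ij))"
        unfolding F_def I_def by (simp add: sum.cartesian_product split_def norm_sum)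
      also have "\<dots> \<le> (\<Sum>ij\<in>I. 2 * n * A N * norm u ^ D1 * exp (norm \<omega> * norm u) ^ D2)"
      proof (rule sum_mono)
        fix ij assume ij: "ij \<in> I"
        have "norm (exp (\<omega> * u)) ^ snd ij \<le> exp (norm \<omega> * norm u) ^ snd ij"
          by (intro power_mono e) auto
        also have "\<dots> \<le> exp (norm \<omega> * norm u) ^ D2"
          using ij by (intro power_increasing) (auto simp: I_def)
        finally show "norm (of_int (p ij) * u ^ fst ij * exp (\<omega> * u) ^ snd ij)
            \<le> 2 * n * A N * norm u ^ D1 * exp (norm \<omega> * norm u) ^ D2"
          unfolding norm_mult norm_power using pbound[OF ij] ij u1 n1 A1[OF N]
          by (intro mult_mono power_increasing) (auto simp: n_def I_def)
      qed
      also have "\<dots> = 2 * n\<^sup>2 * A N * norm u ^ D1 * exp (norm \<omega> * norm u) ^ D2"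
        by (simp add: n_def power2_eq_square)
      also have "\<dots> \<le> 2 * n\<^sup>2 * A T * norm u ^ D1 * exp (norm \<omega> * norm u) ^ D2"
        using A_mono[OF T] by (intro mult_right_mono mult_left_mono) auto
      also have "\<dots> = B T"
        by (simp add: B_def u K_def exp_of_nat_mult[symmetric] mult_ac)
      finally show "norm (F u) \<le> B T" .
    qed
    then show ?thesis by (simp add: cZ)
  qed
  have B0: "0 \<le> B T" if "1 \<le> T" for T
    unfolding B_def using A1[OF that] \<rho> by simp
  have ineq: "real T * (Q ^ (D1 + 2 * T * D2) * (8 * real D ^ 2 * L T ^ (2 * D)) * B T) < 2 ^ (T\<^sup>2)"
    if "N \<le> T" for T
    using param[of T n "A T"] that
    by (simp add: N_def D1_def D2_def A_def L_def B_def n_def cI)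
  have zeros: "\<forall>m<T. \<forall>k<T. F (of_nat m + of_nat k * \<beta>) = 0" if "N \<le> T" for T
    using that
  proof (induction T rule: dec_induct)
    case base
    then show ?case using zeros_N by blast
  next
    case (step T)
    have T1: "1 \<le> T" using step.hyps N by simp
    show ?case
    proof (intro allI impI, rule ccontr)
      fix m k assume mk: "m < Suc T" "k < Suc T" and nz: "F (of_nat m + of_nat k * \<beta>) \<noteq> 0"
      let ?z = "of_nat m + of_nat k * \<beta>" and ?q = "of_int q ^ (D1 + 2 * T * D2) :: complex"
      let ?l = "8 * real D ^ 2 * L T ^ (2 * D)"
      have mk': "m \<le> T" "k \<le> T" using mk by auto
      have l0: "0 \<le> ?l" using L1[OF T1] by simp
      have nq: "norm ?q = Q ^ (D1 + 2 * T * D2)" using q by (simp add: norm_power Q_def)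
      have zT: "norm ?z \<le> 2 * (real T * \<rho>)"
        using grid_norm[OF mk'] \<rho> T1 by (smt (verit) mult_nonneg_nonneg of_nat_0_le_iff)
      have "1 \<le> norm (?q * F ?z) * ?l"
        unfolding D_def
        by (rule liouville_lower_bound[OF W value_acts[OF step.hyps(1) mk'] L1[OF T1]])
           (use nz q in simp)
      also have "\<dots> = Q ^ (D1 + 2 * T * D2) * norm (F ?z) * ?l" by (simp add: norm_mult nq)
      also have "\<dots> \<le> Q ^ (D1 + 2 * T * D2) * (B T / 2 ^ (T\<^sup>2)) * ?l"
        using Q by (intro mult_right_mono mult_left_mono l0 small step.hyps(1) zT) (auto simp: step.IH)
      also have "\<dots> = Q ^ (D1 + 2 * T * D2) * ?l * B T / 2 ^ (T\<^sup>2)" by simp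
      finally have "2 ^ (T\<^sup>2) \<le> Q ^ (D1 + 2 * T * D2) * ?l * B T" by (simp add: field_simps)
      also have "\<dots> \<le> real T * (Q ^ (D1 + 2 * T * D2) * ?l * B T)"
        using T1 l0 Q B0[OF T1] mult_right_mono[of 1 "real T" "Q ^ (D1 + 2 * T * D2) * ?l * B T"] by simp
      finally show False using ineq[OF step.hyps(1)] by simp
    qed
  qed
  have F0: "F w = 0" for w
  proof (rule ccontr)
    assume nz: "F w \<noteq> 0"
    define T where "T = max N (max (nat \<lceil>norm w\<rceil>) (nat \<lceil>1 / norm (F w)\<rceil>))"
    have T: "N \<le> T" by (simp add: T_def)
    have T1: "1 \<le> T" using T N by simp
    have Tw: "norm w \<le> real T" "1 / norm (F w) \<le> real T"
      unfolding T_def by (simp_all add: max_def) linarith+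
    have "real T \<le> 2 * (real T * \<rho>)" using \<rho> T1 mult_left_mono[of 1 \<rho> "real T"] by simp
    then have "norm (F w) \<le> B T / 2 ^ (T\<^sup>2)"
      using zeros[OF T] Tw by (intro small[OF T]) auto
    then have le: "norm (F w) * 2 ^ (T\<^sup>2) \<le> B T" by (simp add: field_simps)
    have "1 \<le> Q ^ (D1 + 2 * T * D2) * (8 * real D ^ 2 * L T ^ (2 * D))"
    proof -
      have "1 \<le> real D ^ 2" using D by simp
      then have "1 \<le> 8 * real D ^ 2" by simp
      moreover have "1 \<le> L T ^ (2 * D)" "1 \<le> Q ^ (D1 + 2 * T * D2)" using L1[OF T1] Q by simp_all
      ultimately show ?thesis
        by (smt (verit) mult_le_cancel_left1)
    qed
    then have "B T \<le> Q ^ (D1 + 2 * T * D2) * (8 * real D ^ 2 * L T ^ (2 * D)) * B T"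
      using B0[OF T1] mult_right_mono by fastforce
    then have "real T * B T < 2 ^ (T\<^sup>2)"
      using ineq[OF T] by (meson mult_left_mono of_nat_0_le_iff order_le_less_trans)
    moreover have "1 \<le> real T * norm (F w)" using Tw(2) nz by (simp add: field_simps)
    then have "2 ^ (T\<^sup>2) \<le> real T * norm (F w) * 2 ^ (T\<^sup>2)"
      using mult_right_mono[of 1 "real T * norm (F w)" "2 ^ (T\<^sup>2)"] by simp
    ultimately show False
      using mult_left_mono[OF le, of "real T"] unfolding mult.assoc by linarith
  qed
  have "p ij = 0" if "ij \<in> I" for ij
  proof -
    have "of_int (p (fst ij, snd ij)) = (0 :: complex)"
      by (rule exponential_polynomial_eq_0[OF \<omega> F0[unfolded F_def]]) (use that in \<open>auto simp: I_def\<close>)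
    then show ?thesis by simp
  qed
  then show False using p by blast
qed

section \<open>The matrix exponential\<close>

lemma matrix_vector_mult_axis_nth: "(A *v axis i 1) $ j = A $ j $ i"
  for A :: "complex^'n^('m::finite)"
  by (simp add: matrix_vector_mult_def axis_def if_distrib[of "\<lambda>z. _ * z"] cong: if_cong)

lemma scaleR_matrix_vector_mult: "(c *\<^sub>R A) *v x = of_real c *s (A *v x)"
  for A :: "complex^'n^('m::finite)"
  by (simp add: vec_eq_iff matrix_vector_mult_def scaleR_conv_of_real[where 'a = complex]
      sum_distrib_left mult.assoc)

lemma mat_exp_sums: "(\<lambda>k. (1 / fact k) *\<^sub>R mat_pow M k) sums mat_exp M"
  unfolding mat_exp_def by (rule summable_sums[OF summable_mat_exp])

text \<open>
  Everything needed about the matrix exponential is an identity between linear images of powers,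
  which passes to the series.
\<close>

lemma mat_exp_linear_sums:
  fixes h :: "complex^'n^('n::finite) \<Rightarrow> 'b::real_normed_vector"
  assumes "linear h"
  shows "(\<lambda>k. (1 / fact k) *\<^sub>R h (mat_pow M k)) sums h (mat_exp M)"
proof -
  have "bounded_linear h" using assms linear_conv_bounded_linear by blast
  from bounded_linear.sums[OF this mat_exp_sums[of M]] show ?thesis
    using assms by (simp add: linear_scale)
qed

lemma mat_exp_eigenvector:
  assumes "M *v y = \<theta> *s y"
  shows "mat_exp M *v y = exp \<theta> *s y"
proof -
  have pow: "mat_pow M k *v y = \<theta> ^ k *s y" for k
    by (induction k)
       (simp_all add: matrix_vector_mul_assoc[symmetric] assms vec.scale mult.commute)
  have "(mat_exp M *v y) $ i = (exp \<theta> *s y) $ i" for i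
  proof (rule sums_unique2)
    have "linear (\<lambda>A. (A *v y) $ i)"
      by (rule linearI) (simp_all add: matrix_vector_mult_add_rdistrib scaleR_matrix_vector_mult scaleR_conv_of_real[where 'a = complex])
    from mat_exp_linear_sums[OF this, of M]
    show "(\<lambda>k. (1 / fact k) *\<^sub>R (\<theta> ^ k * y $ i)) sums (mat_exp M *v y) $ i"
      by (simp add: pow)
    have "(\<lambda>k. (\<theta> ^ k /\<^sub>R fact k) * y $ i) sums (exp \<theta> * y $ i)"
      by (intro sums_mult2 exp_converges)
    then show "(\<lambda>k. (1 / fact k) *\<^sub>R (\<theta> ^ k * y $ i)) sums (exp \<theta> *s y) $ i"
      by (simp add: divide_inverse)
  qed
  then show ?thesis by (simp add: vec_eq_iff)
qed

lemma mat_exp_commute: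
  assumes "M ** B = B ** M"
  shows "mat_exp M ** B = B ** mat_exp M"
proof -
  have pow: "mat_pow M k ** B = B ** mat_pow M k" for k
    by (induction k) (simp_all, metis assms matrix_mul_assoc)
  have "linear (\<lambda>A. A ** B)" "linear (\<lambda>A. B ** A)"
    by (rule linearI; simp add: matrix_matrix_mult_def vec_eq_iff algebra_simps sum.distrib scaleR_sum_right)+
  from mat_exp_linear_sums[OF this(1), of M] mat_exp_linear_sums[OF this(2), of M]
  show ?thesis unfolding pow by (rule sums_unique2)
qed

lemma mat_exp_transpose: "mat_exp (transpose M) = transpose (mat_exp M)"
proof -
  have comm: "mat_pow M k ** M = M ** mat_pow M k" for k
    by (induction k) (simp_all, metis matrix_mul_assoc)
  have pow: "mat_pow (transpose M) k = transpose (mat_pow M k)" for k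
    by (induction k) (simp_all add: comm[symmetric] matrix_transpose_mul transpose_mat)
  have "linear (transpose :: complex^'n^'n \<Rightarrow> _)"
    by (rule linearI) (simp_all add: transpose_def vec_eq_iff)
  from mat_exp_linear_sums[OF this, of M, folded pow]
  show ?thesis by (rule sums_unique2[OF mat_exp_sums])
qed

section \<open>Eigenvalues of integer matrices\<close>

text \<open>
  The vector \<open>p(M) x\<close>, by Horner's scheme; the matrix \<open>p(M)\<close> itself is never formed.
\<close>

definition poly_act :: "complex^'n^('n::finite) \<Rightarrow> complex poly \<Rightarrow> complex^'n \<Rightarrow> complex^'n" where
  "poly_act M p x = fold_coeffs (\<lambda>c y. c *s x + M *v y) p 0"

lemma poly_act_0 [simp]: "poly_act M 0 x = 0"
  by (simp add: poly_act_def)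

lemma poly_act_pCons [simp]: "poly_act M (pCons c p) x = c *s x + M *v poly_act M p x"
  by (cases "p = 0 \<and> c = 0") (auto simp: poly_act_def)

lemma poly_act_add: "poly_act M (p + q) x = poly_act M p x + poly_act M q x"
  by (induction p q rule: poly_induct2)
     (simp_all add: matrix_vector_right_distrib vec.scale_left_distrib algebra_simps)

lemma poly_act_smult: "poly_act M (smult c p) x = c *s poly_act M p x"
  by (induction p) (simp_all add: vec.scale vec.scale_right_distrib)

lemma poly_act_monom: "poly_act M (monom c k) x = c *s (mat_pow M k *v x)"
  by (induction k) (simp_all add: monom_0 monom_Suc vec.scale matrix_vector_mul_assoc[symmetric])

lemma poly_act_sum: "poly_act M (\<Sum>k\<in>K. f k) x = (\<Sum>k\<in>K. poly_act M (f k) x)"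
  by (induction K rule: infinite_finite_induct) (simp_all add: poly_act_add)

lemma poly_act_intertwine:
  assumes "\<And>x. A *v (M *v x) = \<theta> *s (A *v x)"
  shows "A *v poly_act M p x = poly p \<theta> *s (A *v x)"
  by (induction p)
     (simp_all add: matrix_vector_right_distrib vec.scale assms vec.scale_left_distrib mult.commute)

lemma poly_act_commute:
  assumes "U ** M = M ** U"
  shows "poly_act M p (U *v x) = U *v poly_act M p x"
proof (induction p)
  case (pCons c p)
  have "M *v (U *v z) = U *v (M *v z)" for z
    by (simp add: matrix_vector_mul_assoc assms)
  then show ?case using pCons by (simp add: matrix_vector_right_distrib vec.scale)
qed simp

lemma algebraic_sum:
  fixes f :: "'a \<Rightarrow> complex"
  shows "(\<And>i. i \<in> I \<Longrightarrow> algebraic (f i)) \<Longrightarrow> algebraic (\<Sum>i\<in>I. f i)"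
  by (induction I rule: infinite_finite_induct) (auto intro: algebraic_add)

lemma algebraic_poly_act:
  fixes M :: "complex^'n^('n::finite)" and x :: "complex^'n"
  assumes "\<And>i j. algebraic (M $ i $ j)" "\<And>k. algebraic (coeff p k)" "\<And>i. algebraic (x $ i)"
  shows "algebraic (poly_act M p x $ i)"
  using assms(2)
proof (induction p arbitrary: i)
  case (pCons c p)
  have "algebraic (coeff p k)" for k using pCons.prems[of "Suc k"] by simp
  then have "algebraic (poly_act M p x $ j)" for j by (rule pCons.IH)
  moreover have "algebraic c" using pCons.prems[of 0] by simp
  ultimately show ?case
    by (auto simp: matrix_vector_mult_def intro!: algebraic_add algebraic_mult algebraic_sum assms)
qed simp

lemma algebraic_poly:
  fixes p :: "complex poly"
  assumes "\<And>k. algebraic (coeff p k)" "algebraic \<theta>"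
  shows "algebraic (poly p \<theta>)"
  using assms(1)
proof (induction p)
  case (pCons c p)
  have "algebraic (coeff p k)" for k using pCons.prems[of "Suc k"] by simp
  moreover have "algebraic c" using pCons.prems[of 0] by simp
  ultimately show ?case using pCons.IH assms(2) by (auto intro: algebraic_add algebraic_mult)
qed simp

text \<open>
  Dividing out a root keeps the coefficients algebraic: by Horner's scheme, the coefficients of the
  quotient are values at \<open>\<theta>\<close> of polynomials with the same coefficients.
\<close>

lemma algebraic_synthetic_div:
  fixes p :: "complex poly"
  assumes "\<And>k. algebraic (coeff p k)" "algebraic \<theta>"
  shows "algebraic (coeff (synthetic_div p \<theta>) k)"
  using assms(1)
proof (induction p arbitrary: k)
  case (pCons c p)
  have "algebraic (coeff p k)" for k using pCons.prems[of "Suc k"] by simp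
  then show ?case
    using pCons.IH algebraic_poly[of p \<theta>] assms(2) by (simp add: coeff_pCons split: nat.split)
qed simp

text \<open>
  The integer vectors \<open>x, M x, M\<^sup>2 x, \<dots>\<close> are linearly dependent; Siegel's lemma supplies a
  relation with integer coefficients.
\<close>

lemma integral_annihilator:
  fixes M :: "complex^'n^('n::finite)" and x :: "complex^'n"
  assumes M: "\<And>i j. M $ i $ j \<in> \<int>" and x: "\<And>i. x $ i \<in> \<int>"
  obtains p where "p \<noteq> 0" "\<And>k. coeff p k \<in> \<int>" "poly_act M p x = 0"
proof -
  have "(mat_pow M k *v x) $ i \<in> \<int>" for k i
  proof (induction k arbitrary: i)
    case (Suc k)
    have "(mat_pow M (Suc k) *v x) $ i = (\<Sum>j\<in>UNIV. M $ i $ j * (mat_pow M k *v x) $ j)"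
      by (simp add: matrix_vector_mul_assoc[symmetric] matrix_vector_mult_def[of M])
    then show ?case using M Suc by (auto intro!: Ints_sum Ints_mult)
  qed (simp add: x)
  then have "\<exists>z. (mat_pow M k *v x) $ i = of_int z" for k i unfolding Ints_def by blast
  then obtain z where z: "\<And>k i. (mat_pow M k *v x) $ i = of_int (z k i)" by metis
  let ?K = "{..<2 * CARD('n)}"
  define A where "A = 1 + (\<Sum>i\<in>UNIV. \<Sum>k\<in>?K. \<bar>real_of_int (z k i)\<bar>)"
  obtain b where b: "\<exists>k\<in>?K. b k \<noteq> 0" "\<And>i. i \<in> UNIV \<Longrightarrow> (\<Sum>k\<in>?K. z k i * b k) = 0"
  proof (rule siegel[of ?K "UNIV :: 'n set" A "\<lambda>i k. z k i"])
    show "1 \<le> A" by (simp add: A_def sum_nonneg)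
    show "\<bar>real_of_int (z k i)\<bar> \<le> A" if "k \<in> ?K" for i k
    proof -
      have "\<bar>real_of_int (z k i)\<bar> \<le> (\<Sum>k\<in>?K. \<bar>real_of_int (z k i)\<bar>)"
        using that by (intro member_le_sum) auto
      also have "\<dots> \<le> (\<Sum>i\<in>UNIV. \<Sum>k\<in>?K. \<bar>real_of_int (z k i)\<bar>)"
        by (rule member_le_sum[of i UNIV "\<lambda>i. \<Sum>k\<in>?K. \<bar>real_of_int (z k i)\<bar>"]) (auto intro: sum_nonneg)
      finally show ?thesis by (simp add: A_def)
    qed
    show "?K \<noteq> {}" by (auto simp: lessThan_empty_iff)
  qed auto
  define p where "p = (\<Sum>k\<in>?K. monom (of_int (b k)) k :: complex poly)"
  have cf: "coeff p k = (if k \<in> ?K then of_int (b k) else 0)" for k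
    by (simp add: p_def coeff_sum)
  show ?thesis
  proof (rule that)
    show "p \<noteq> 0" using b(1) cf by (metis coeff_0 of_int_eq_0_iff)
    show "coeff p k \<in> \<int>" for k by (simp add: cf)
    have "poly_act M p x $ i = 0" for i
    proof -
      have "poly_act M p x $ i = (\<Sum>k\<in>?K. of_int (b k) * of_int (z k i))"
        by (simp add: p_def poly_act_sum poly_act_monom z)
      also have "\<dots> = of_int (\<Sum>k\<in>?K. z k i * b k)" by (simp add: mult.commute)
      finally show ?thesis using b(2) by simp
    qed
    then show "poly_act M p x = 0" by (simp add: vec_eq_iff)
  qed
qed

lemma algebraic_of_Ints: "(x :: complex) \<in> \<int> \<Longrightarrow> algebraic x"
  by (auto elim!: Ints_cases)

text \<open>
  Projecting \<open>e\<close> to an eigenspace yields an eigenvector, but one produced by a polynomial with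
  algebraic coefficients is wanted. Take \<open>p\<close> of least degree among the nonzero polynomials with algebraic coefficients
  that satisfy \<open>p(M) e = 0\<close>. Applying \<open>F\<close> shows \<open>p(\<theta>) = 0\<close>, and \<open>g = p / (X - \<theta>)\<close> has
  \<open>g(M) e \<noteq> 0\<close> by minimality while \<open>(M - \<theta>) g(M) e = p(M) e = 0\<close>. The matrix \<open>F\<close> stands for the
  projection to the \<open>\<theta>\<close>-eigenspace.
\<close>

lemma algebraic_eigenvector_polynomial:
  fixes M F :: "complex^'n^('n::finite)" and e :: "complex^'n"
  assumes M: "\<And>i j. M $ i $ j \<in> \<int>" and e: "\<And>i. e $ i \<in> \<int>"
    and F: "\<And>x. F *v (M *v x) = \<theta> *s (F *v x)" and Fe: "F *v e \<noteq> 0"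
  obtains g where "algebraic \<theta>" "\<And>k. algebraic (coeff g k)" "poly_act M g e \<noteq> 0"
    "M *v poly_act M g e = \<theta> *s poly_act M g e"
proof -
  have root: "poly p \<theta> = 0" if "poly_act M p e = 0" for p
    using poly_act_intertwine[of F M \<theta> p e, OF F] that Fe by simp
  obtain p0 where p0: "p0 \<noteq> 0" "\<And>k. coeff p0 k \<in> \<int>" "poly_act M p0 e = 0"
    using integral_annihilator[OF M e] by blast
  have \<theta>: "algebraic \<theta>" by (rule algebraicI[OF p0(2,1) root[OF p0(3)]])
  define P where "P p \<longleftrightarrow> p \<noteq> 0 \<and> (\<forall>k. algebraic (coeff p k)) \<and> poly_act M p e = 0" for p
  have "P p0" using p0 by (auto simp: P_def intro: algebraic_of_Ints)
  then obtain p where p: "P p" "\<And>q. P q \<Longrightarrow> degree p \<le> degree q"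
    using ex_has_least_nat[of P p0 degree] by blast
  have p\<theta>: "poly p \<theta> = 0" using p(1) root by (simp add: P_def)
  have deg: "degree p \<noteq> 0"
  proof
    assume "degree p = 0"
    then obtain c where "p = [:c:]" by (rule degree_eq_zeroE)
    then show False using p(1) p\<theta> by (simp add: P_def)
  qed
  define g where "g = synthetic_div p \<theta>"
  have g0: "g \<noteq> 0" using deg by (simp add: g_def synthetic_div_eq_0_iff)
  have galg: "algebraic (coeff g k)" for k
    unfolding g_def using p(1) \<theta> by (intro algebraic_synthetic_div) (auto simp: P_def)
  have "degree g < degree p" using deg by (simp add: g_def degree_synthetic_div)
  then have "\<not> P g" using p(2) by fastforce
  then have ge: "poly_act M g e \<noteq> 0" using g0 galg by (simp add: P_def)
  have "p = pCons 0 g + smult (- \<theta>) g"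
    using synthetic_div_correct'[of \<theta> p] p\<theta> by (simp add: g_def add.commute)
  then have "poly_act M p e = poly_act M (pCons 0 g + smult (- \<theta>) g) e"
    by (rule arg_cong)
  also have "\<dots> = M *v poly_act M g e - \<theta> *s poly_act M g e"
    unfolding poly_act_add poly_act_smult poly_act_pCons by simp
  finally have "M *v poly_act M g e = \<theta> *s poly_act M g e" using p(1) by (simp add: P_def)
  then show ?thesis by (rule that[OF \<theta> galg ge])
qed

text \<open>
  With \<open>g\<close> as before, \<open>y = g(M) e\<close> is an eigenvector with algebraic entries, and as \<open>g(M)\<close> commutes
  with \<open>exp (t M)\<close>, the vector \<open>g(M) exp (t M) e = exp (t \<theta>) y\<close> has algebraic entries too. A nonzero
  entry of \<open>y\<close> exhibits \<open>exp (t \<theta>)\<close> as a quotient of algebraic numbers.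
\<close>

lemma algebraic_exp_eigenvalue:
  fixes M F :: "complex^'n^('n::finite)" and e :: "complex^'n"
  assumes M: "\<And>i j. M $ i $ j \<in> \<int>" and e: "\<And>i. e $ i \<in> \<int>"
    and F: "\<And>x. F *v (M *v x) = \<theta> *s (F *v x)" and Fe: "F *v e \<noteq> 0"
    and v: "\<And>i. algebraic ((mat_exp (t *\<^sub>R M) *v e) $ i)"
  shows "algebraic \<theta>" "algebraic (exp (of_real t * \<theta>))"
proof -
  obtain g where g: "algebraic \<theta>" "\<And>k. algebraic (coeff g k)" "poly_act M g e \<noteq> 0"
    "M *v poly_act M g e = \<theta> *s poly_act M g e"
    using algebraic_eigenvector_polynomial[OF M e F Fe] by metis
  show "algebraic \<theta>" by (rule g)
  let ?y = "poly_act M g e" and ?v = "mat_exp (t *\<^sub>R M) *v e"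
  have "(t *\<^sub>R M) *v ?y = (of_real t * \<theta>) *s ?y"
    by (simp add: scaleR_matrix_vector_mult g(4))
  then have "mat_exp (t *\<^sub>R M) *v ?y = exp (of_real t * \<theta>) *s ?y"
    by (rule mat_exp_eigenvector)
  moreover have "mat_exp (t *\<^sub>R M) ** M = M ** mat_exp (t *\<^sub>R M)"
    by (rule mat_exp_commute) (simp add: matrix_matrix_mult_def vec_eq_iff)
  ultimately have eq: "poly_act M g ?v = exp (of_real t * \<theta>) *s ?y"
    by (simp add: poly_act_commute)
  obtain u where u: "?y $ u \<noteq> 0" using g(3) by (auto simp: vec_eq_iff)
  have "exp (of_real t * \<theta>) = poly_act M g ?v $ u * inverse (?y $ u)"
    using u by (simp add: eq)
  moreover have "algebraic (poly_act M g ?v $ u)" "algebraic (?y $ u)"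
    by (intro algebraic_poly_act g v algebraic_of_Ints M e)+
  ultimately show "algebraic (exp (of_real t * \<theta>))" by (auto intro: algebraic_mult)
qed

section \<open>Oriented graphs with local uniform mixing\<close>

lemma skew_adjacency_transpose:
  assumes "oriented_graph E"
  shows "transpose (skew_adjacency E) = - skew_adjacency E"
  using assms by (auto simp: skew_adjacency_def oriented_graph_def transpose_def vec_eq_iff)

text \<open>
  The projection commutes with the skew-Hermitian matrix: take adjoints in \<open>S F = \<theta> F\<close> and use
  \<open>S\<^sup>* = - S\<close> and \<open>cnj \<theta> = - \<theta>\<close>.
\<close>

lemma eigenprojection_intertwine:
  assumes E: "oriented_graph E" and \<theta>: "cnj \<theta> = - \<theta>"
  shows "eigenprojection (skew_adjacency E) \<theta> *v (skew_adjacency E *v x)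
    = \<theta> *s (eigenprojection (skew_adjacency E) \<theta> *v x)"
proof -
  define S where "S = skew_adjacency E"
  define F where "F = eigenprojection S \<theta>"
  have F: "conj_transpose F = F" "range (\<lambda>x. F *v x) = eigenspace S \<theta>"
    using is_orth_projection_eigenprojection[of S \<theta>] by (auto simp: is_orth_projection_def F_def)
  have SF: "S *v (F *v x) = \<theta> *s (F *v x)" for x
    using F(2) by (auto simp: eigenspace_def)
  have ent: "(S ** F) $ j $ i = \<theta> * F $ j $ i" for i j
  proof -
    have "((S ** F) *v axis i 1) $ j = (\<theta> *s (F *v axis i 1)) $ j"
      by (simp add: matrix_vector_mul_assoc[symmetric] SF)
    then show ?thesis by (simp add: matrix_vector_mult_axis_nth)
  qed
  have S: "conj_transpose S = - S"
  proof -
    have "cnj (S $ i $ j) = S $ i $ j" for i j by (simp add: S_def skew_adjacency_def)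
    then have "conj_transpose S = transpose S" by (simp add: conj_transpose_def transpose_def vec_eq_iff)
    then show ?thesis using skew_adjacency_transpose[OF E] by (simp add: S_def)
  qed
  have "(F ** S) $ i $ j = \<theta> * F $ i $ j" for i j
  proof -
    have "(F ** S) $ i $ j = cnj (conj_transpose (F ** S) $ j $ i)"
      by (simp add: conj_transpose_def)
    also have "conj_transpose (F ** S) = - (S ** F)"
      by (simp only: conj_transpose_mult F S) (simp add: matrix_matrix_mult_def vec_eq_iff sum_negf)
    also have "cnj ((- (S ** F)) $ j $ i) = \<theta> * cnj (F $ j $ i)"
      by (simp add: ent \<theta>)
    also have "cnj (F $ j $ i) = conj_transpose F $ i $ j" by (simp add: conj_transpose_def)
    finally show ?thesis by (simp add: F)
  qed
  then have "(F ** S) *v x = \<theta> *s (F *v x)"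
    by (simp add: matrix_vector_mult_def vec_eq_iff sum_distrib_left mult.assoc)
  then show ?thesis by (simp add: matrix_vector_mul_assoc F_def S_def)
qed

text \<open>
  Since \<open>S\<close> is skew-symmetric, \<open>U(-t)\<close> is the transpose of \<open>U(t)\<close>, so the diagonal of the evolved
  density consists of squares, rather than only squared absolute values, of the amplitudes. This
  makes the amplitudes algebraic.
\<close>

lemma local_uniform_mixing_amplitude:
  fixes E :: "('v::finite \<times> 'v) set"
  assumes E: "oriented_graph E" and "local_uniform_mixing E a"
  obtains t where "\<And>u. ((transition E t *v axis a 1) $ u) ^ 2 = of_real (1 / real CARD('v))"
proof -
  obtain t where t: "schur_product (evolved_density E a t) (mat 1) = (1 / real CARD('v)) *\<^sub>R mat 1"
    using assms(2) by (auto simp: local_uniform_mixing_def)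
  let ?U = "transition E t"
  have U: "transition E (- t) = transpose ?U"
  proof -
    have "(- t) *\<^sub>R skew_adjacency E = transpose (t *\<^sub>R skew_adjacency E)"
    proof -
      have "transpose (t *\<^sub>R skew_adjacency E) = t *\<^sub>R transpose (skew_adjacency E)"
        by (simp add: vec_eq_iff transpose_def)
      then show ?thesis by (simp add: skew_adjacency_transpose[OF E])
    qed
    then show ?thesis by (simp only: transition_def mat_exp_transpose)
  qed
  have "((?U *v axis a 1) $ u) ^ 2 = of_real (1 / real CARD('v))" for u
  proof -
    have left: "(?U ** vertex_density a) $ u $ k = (if k = a then ?U $ u $ a else 0)" for k
      by (cases "k = a") (simp_all add: vertex_density_def matrix_matrix_mult_def axis_def
          if_distrib[of "\<lambda>z. _ * z"] cong: if_cong)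
    have "evolved_density E a t $ u $ u
        = (\<Sum>k\<in>UNIV. (?U ** vertex_density a) $ u $ k * transition E (- t) $ k $ u)"
      by (simp add: evolved_density_def matrix_matrix_mult_def[of "_ ** _"])
    also have "\<dots> = ?U $ u $ a * transition E (- t) $ a $ u"
      unfolding left by (simp add: if_distrib[of "\<lambda>z. z * _"] cong: if_cong)
    also have "\<dots> = (?U $ u $ a) ^ 2" by (simp add: U transpose_def power2_eq_square)
    finally have "(?U $ u $ a) ^ 2 = schur_product (evolved_density E a t) (mat 1) $ u $ u"
      by (simp add: schur_product_def mat_def)
    then show ?thesis unfolding t
      by (simp add: mat_def matrix_vector_mult_axis_nth scaleR_conv_of_real[where 'a = complex])
  qed
  then show ?thesis by (rule that)
qed

text \<open>
  At time 0 the walk has not left its starting vertex, so mixing forces that vertex to be the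
  only one.
\<close>

lemma mixing_at_time_0_imp_no_arcs:
  fixes E :: "('v::finite \<times> 'v) set"
  assumes E: "oriented_graph E" and "((transition E 0 *v axis a 1) $ a) ^ 2 = of_real (1 / real CARD('v))"
  shows "skew_adjacency E = 0"
proof -
  have "mat_exp 0 *v axis a 1 = exp 0 *s (axis a 1 :: complex^'v)"
    by (rule mat_exp_eigenvector) (simp add: matrix_vector_mult_def vec_eq_iff)
  then have "transition E 0 *v axis a 1 = axis a 1" by (simp add: transition_def)
  then have "1 = (of_real (1 / real CARD('v)) :: complex)" using assms(2) by simp
  then have "CARD('v) = 1" by (simp add: field_simps)
  then obtain w :: 'v where "UNIV = {w}" by (rule card_1_singletonE)
  then have eq: "u = w" for u by auto
  then have "E = {}" using E unfolding oriented_graph_def by (metis equals0I surj_pair)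
  then show ?thesis by (simp add: skew_adjacency_def vec_eq_iff)
qed

theorem theorem8p2:
  fixes E :: "('v::finite \<times> 'v) set" and a :: 'v
  assumes "oriented_graph E"
    and "local_uniform_mixing E a"
  shows "ratio_condition (eigenvalue_support E a)"
proof -
  define S where "S = skew_adjacency E"
  obtain t where t: "\<And>u. ((transition E t *v axis a 1) $ u) ^ 2 = of_real (1 / real CARD('v))"
    using local_uniform_mixing_amplitude[OF assms] by blast
  have alg: "algebraic (\<i> * of_real \<mu>)" "algebraic (exp (of_real t * (\<i> * of_real \<mu>)))"
    if \<mu>: "\<i> * of_real \<mu> \<in> eigenvalue_support E a" for \<mu> :: real
  proof -
    let ?F = "eigenprojection S (\<i> * of_real \<mu>)"
    have Fe: "?F *v axis a 1 \<noteq> 0" using \<mu> by (simp add: eigenvalue_support_def S_def)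
    have v: "algebraic ((mat_exp (t *\<^sub>R S) *v axis a 1) $ u)" for u
    proof -
      have "algebraic (inverse (of_nat CARD('v)) :: complex)" by (intro algebraic_inverse) simp
      then have "algebraic (poly (monom 1 2) ((mat_exp (t *\<^sub>R S) *v axis a 1) $ u))"
        using t[of u] by (simp add: poly_monom transition_def S_def divide_inverse)
      then show ?thesis by (rule algebraic_root) (auto simp: degree_monom_eq)
    qed
    have F: "?F *v (S *v x) = (\<i> * of_real \<mu>) *s (?F *v x)" for x
      unfolding S_def by (rule eigenprojection_intertwine[OF assms(1)]) simp
    have S: "S $ i $ j \<in> \<int>" for i j by (simp add: S_def skew_adjacency_def)
    have e: "(axis a 1 :: complex^'v) $ i \<in> \<int>" for i by (simp add: axis_def)
    show "algebraic (\<i> * of_real \<mu>)" "algebraic (exp (of_real t * (\<i> * of_real \<mu>)))"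
      using algebraic_exp_eigenvalue[OF S e F Fe v] by auto
  qed
  have rat: "\<mu> / \<nu> \<in> \<rat>"
    if mem: "\<i> * of_real \<mu> \<in> eigenvalue_support E a" "\<i> * of_real \<nu> \<in> eigenvalue_support E a" "\<nu> \<noteq> 0"
    for \<mu> \<nu> :: real
  proof (rule ccontr)
    assume irr: "\<mu> / \<nu> \<notin> \<rat>"
    have "t \<noteq> 0"
    proof
      assume "t = 0"
      then have "S = 0" using mixing_at_time_0_imp_no_arcs[OF assms(1)] t[of a] by (simp add: S_def)
      moreover obtain x where "S *v x = (\<i> * of_real \<nu>) *s x" "x \<noteq> 0"
        using mem(2) by (auto simp: eigenvalue_support_def is_eigenvalue_def eigenspace_def S_def)
      ultimately show False using mem(3) by simp
    qed
    have "complex_of_real (\<mu> / \<nu>) \<notin> \<rat>" using irr by (simp only: Rats_complex_of_real_iff not_False_eq_True)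
    moreover have "algebraic (complex_of_real (\<mu> / \<nu>))"
    proof -
      have eq: "complex_of_real (\<mu> / \<nu>) = (\<i> * of_real \<mu>) * inverse (\<i> * of_real \<nu>)"
        using mem(3) by (simp add: field_simps)
      show ?thesis unfolding eq by (intro algebraic_mult algebraic_inverse alg(1) mem)
    qed
    ultimately have "\<not> algebraic (exp (of_real (\<mu> / \<nu>) * (of_real t * (\<i> * of_real \<nu>))))"
      using \<open>t \<noteq> 0\<close> mem(3) by (intro gelfond_schneider alg(2)[OF mem(2)]) auto
    moreover have "of_real (\<mu> / \<nu>) * (of_real t * (\<i> * of_real \<nu>)) = of_real t * (\<i> * of_real \<mu>)"
      using mem(3) by simp
    ultimately show False using alg(2)[OF mem(1)] by simp
  qed
  show ?thesis
    unfolding ratio_condition_def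
  proof (intro allI impI, elim conjE)
    fix \<mu>\<^sub>r \<mu>\<^sub>s \<mu>\<^sub>k \<mu>\<^sub>l :: real
    let ?\<Phi> = "eigenvalue_support E a"
    assume supp: "\<i> * of_real \<mu>\<^sub>r \<in> ?\<Phi>" "\<i> * of_real \<mu>\<^sub>s \<in> ?\<Phi>" "\<i> * of_real \<mu>\<^sub>k \<in> ?\<Phi>"
      "\<i> * of_real \<mu>\<^sub>l \<in> ?\<Phi>" and ne: "\<mu>\<^sub>k \<noteq> \<mu>\<^sub>l"
    \<comment> \<open>Dividing by one nonzero eigenvalue turns all four eigenvalues into rational multiples of it.\<close>
    obtain \<nu> :: real where \<nu>: "\<nu> \<noteq> 0" "\<i> * of_real \<nu> \<in> ?\<Phi>"
      using supp(3,4) ne by (cases "\<mu>\<^sub>k = 0") auto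
    have "(\<mu>\<^sub>r / \<nu> - \<mu>\<^sub>s / \<nu>) / (\<mu>\<^sub>k / \<nu> - \<mu>\<^sub>l / \<nu>) \<in> \<rat>"
      by (intro Rats_divide Rats_diff rat supp \<nu>)
    also have "(\<mu>\<^sub>r / \<nu> - \<mu>\<^sub>s / \<nu>) / (\<mu>\<^sub>k / \<nu> - \<mu>\<^sub>l / \<nu>) = (\<mu>\<^sub>r - \<mu>\<^sub>s) / (\<mu>\<^sub>k - \<mu>\<^sub>l)"
      using \<nu>(1) by (simp flip: diff_divide_distrib)
    finally show "(\<mu>\<^sub>r - \<mu>\<^sub>s) / (\<mu>\<^sub>k - \<mu>\<^sub>l) \<in> \<rat>" .
  qed
qed

end
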